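(* Let $c>3$, and consider the two-vortex Hamiltonian system on the phase space $\mathcal P$ with integrals $F$, $H$ and momentum map $\mathcal F=(F,H):\mathcal P\to\mathbb R^2$, as given in the context. Let $(AB)\subset\mathbb R^2(f,h)$ be the open arc of the bifurcation diagram between the points $A$ and $B$, that is, the set of points $$f=\frac{c s^2-2(s-1)(c+s-1)}{c+s-1},\qquad h=\frac12\ln\left[\frac{s^2(s-1)}{c+s-1}\right]-\frac c2\ln\left[\frac{c s^2}{c+s-1}\right]$$ with $s_A<s<s_B$, where $$s_A=\frac{\bigl[2-c+\sqrt{c(c-2)}\bigr](c-1)}{c-2},\qquad s_B=\frac{2(1+\sqrt c)}{2+\sqrt c}.$$ Then, upon crossing the arc $(AB)$, the integral surface $\mathcal F^{-1}(f,h)$ undergoes a bifurcation of three Liouville tori into one, $$3\,\mathbb T^2\ \longrightarrow\ \mathbb S^1\times\bigl(\mathbb S^1\,\dot\cup\,\mathbb S^1\,\dot\cup\,\mathbb S^1\bigr)\ \longrightarrow\ \mathbb T^2 .$$ That is, for every point $P\in(AB)$: the critical integral surface $\mathcal F^{-1}(P)$ is a trivial bundle over $\mathbb S^1$ with fibre $\mathbb S^1\,\dot\cup\,\mathbb S^1\,\dot\cup\,\mathbb S^1$; and for all points $(f,h)\notin(AB)$ sufficiently close to $P$, the surface $\mathcal F^{-1}(f,h)$ is a disjoint union of three two-dimensional tori if $(f,h)$ lies on one side of $(AB)$, and is a single two-dimensional torus if $(f,h)$ lies on the other side.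
   Context: The system describes two vortices of identical intensities $\Gamma_1=\Gamma_2=1$ in a Bose–Einstein condensate in a harmonic trap, with positive parameter $c$. The phase space is $$\mathcal P=\{(x_1,y_1,x_2,y_2)\in\mathbb R^4: x_1^2+y_1^2<1,\ x_2^2+y_2^2<1\}\setminus\{x_1=x_2,\ y_1=y_2\}.$$ The equations of motion are $x_k'=\partial H/\partial y_k$, $y_k'=-\partial H/\partial x_k$, $k=1,2$, with Hamiltonian $$H=\tfrac12\ln\bigl[1-(x_1^2+y_1^2)\bigr]+\tfrac12\ln\bigl[1-(x_2^2+y_2^2)\bigr]-\tfrac c2\ln\bigl[(x_2-x_1)^2+(y_2-y_1)^2\bigr].$$ The additional first integral (moment of vorticity) is $F=x_1^2+y_1^2+x_2^2+y_2^2$. The momentum map is $\mathcal F:\mathcal P\to\mathbb R^2$, $\mathcal F(\zeta)=(F(\zeta),H(\zeta))=(f,h)$. The bifurcation diagram is the set of critical values of $\mathcal F$, i.e. the image of the set of points of $\mathcal P$ where $\operatorname{rank}d\mathcal F<2$. The bifurcation diagram consists of the curve $\gamma_1:\ h=\ln(1-f/2)-\frac c2\ln(2f)$, $0<f<2$, and the curve $\gamma_2$ given parametrically by $$f=\frac{c s^2-2(s-1)(c+s-1)}{c+s-1},\qquad h=\frac12\ln\left[\frac{s^2(s-1)}{c+s-1}\right]-\frac c2\ln\left[\frac{c s^2}{c+s-1}\right]$$ for $s\in(1,s_B]$, where $s_B=\frac{2(1+\sqrt c)}{2+\sqrt c}$. The point $A$ (parameter $s=s_A=\frac{[2-c+\sqrt{c(c-2)}](c-1)}{c-2}$)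 is the cusp of $\gamma_2$, and $B$ (parameter $s=s_B$) is the point of tangency of $\gamma_2$ with $\gamma_1$. The symbol $\mathbb S^1\,\dot\cup\,\mathbb S^1\,\dot\cup\,\mathbb S^1$ denotes a chain of three circles touching successively: the middle circle shares exactly one point with each of the other two circles, these two points are distinct, and there are no other common points. *)

theory Defs
  imports "HOL-Analysis.Analysis"
begin

text \<open>A point of the phase space is written \<open>(x1, y1, x2, y2)\<close>, and a point of the plane
  of integral values is written \<open>(f, h)\<close>.\<close>

definition phase_space :: "(real \<times> real \<times> real \<times> real) set" where
  "phase_space = {(x1, y1, x2, y2). x1\<^sup>2 + y1\<^sup>2 < 1 \<and> x2\<^sup>2 + y2\<^sup>2 < 1}
                 - {(x1, y1, x2, y2). x1 = x2 \<and> y1 = y2}"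

definition hamiltonian :: "real \<Rightarrow> real \<times> real \<times> real \<times> real \<Rightarrow> real" where
  "hamiltonian c = (\<lambda>(x1, y1, x2, y2).
      1/2 * ln (1 - (x1\<^sup>2 + y1\<^sup>2)) + 1/2 * ln (1 - (x2\<^sup>2 + y2\<^sup>2))
      - c/2 * ln ((x2 - x1)\<^sup>2 + (y2 - y1)\<^sup>2))"

definition vorticity_moment :: "real \<times> real \<times> real \<times> real \<Rightarrow> real" where
  "vorticity_moment = (\<lambda>(x1, y1, x2, y2). x1\<^sup>2 + y1\<^sup>2 + x2\<^sup>2 + y2\<^sup>2)"

definition momentum_map :: "real \<Rightarrow> real \<times> real \<times> real \<times> real \<Rightarrow> real \<times> real" where
  "momentum_map c \<zeta> = (vorticity_moment \<zeta>, hamiltonian c \<zeta>)"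

definition integral_surface :: "real \<Rightarrow> real \<times> real \<Rightarrow> (real \<times> real \<times> real \<times> real) set" where
  "integral_surface c p = {\<zeta> \<in> phase_space. momentum_map c \<zeta> = p}"

text \<open>The dimension of the range of the Frechet derivative is the rank of the differential;
  \<^const>\<open>momentum_map\<close> is differentiable at every point of the open set \<^const>\<open>phase_space\<close>.\<close>

definition critical_points :: "real \<Rightarrow> (real \<times> real \<times> real \<times> real) set" where
  "critical_points c =
     {\<zeta> \<in> phase_space. dim (range (frechet_derivative (momentum_map c) (at \<zeta>))) < 2}"

definition bifurcation_diagram :: "real \<Rightarrow> (real \<times> real) set" where
  "bifurcation_diagram c = momentum_map c ` critical_points c"

definition gamma2 :: "real \<Rightarrow> real \<Rightarrow> real \<times> real" where
  "gamma2 c s =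
     ((c * s\<^sup>2 - 2 * (s - 1) * (c + s - 1)) / (c + s - 1),
      1/2 * ln (s\<^sup>2 * (s - 1) / (c + s - 1)) - c/2 * ln (c * s\<^sup>2 / (c + s - 1)))"

definition s_A :: "real \<Rightarrow> real" where
  "s_A c = (2 - c + sqrt (c * (c - 2))) * (c - 1) / (c - 2)"

definition s_B :: "real \<Rightarrow> real" where
  "s_B c = 2 * (1 + sqrt c) / (2 + sqrt c)"

definition arc_AB :: "real \<Rightarrow> (real \<times> real) set" where
  "arc_AB c = gamma2 c ` {s_A c <..< s_B c}"

abbreviation circle :: "complex set" where
  "circle \<equiv> sphere 0 1"

definition three_circle_chain :: "complex set" where
  "three_circle_chain = sphere 0 1 \<union> sphere 2 1 \<union> sphere 4 1"

lemma three_circle_chain_contacts: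
  "sphere (0::complex) 1 \<inter> sphere 2 1 = {1}"
  "sphere (2::complex) 1 \<inter> sphere 4 1 = {3}"
  "sphere (0::complex) 1 \<inter> sphere 4 1 = {}"
proof -
  have iff: "z \<in> sphere (of_real a) 1 \<longleftrightarrow> (a - Re z)\<^sup>2 + (Im z)\<^sup>2 = 1" for a and z :: complex
    by (simp add: dist_norm cmod_def)
  note sph = iff[of _ 0, unfolded of_real_0] iff[of _ 2, unfolded of_real_numeral]
    iff[of _ 4, unfolded of_real_numeral]
  have "z = 1" if "(Re z)\<^sup>2 + (Im z)\<^sup>2 = 1" "(2 - Re z)\<^sup>2 + (Im z)\<^sup>2 = 1" for z
  proof -
    have "Re z = 1" using that by (simp add: power2_eq_square algebra_simps)
    then show ?thesis using that by (simp add: complex_eq_iff)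
  qed
  then show "sphere (0::complex) 1 \<inter> sphere 2 1 = {1}"
    by (auto simp: sph simp del: mem_sphere mem_sphere_0)
  have "z = 3" if "(2 - Re z)\<^sup>2 + (Im z)\<^sup>2 = 1" "(4 - Re z)\<^sup>2 + (Im z)\<^sup>2 = 1" for z
  proof -
    have "Re z = 3" using that by (simp add: power2_eq_square algebra_simps)
    then show ?thesis using that by (simp add: complex_eq_iff)
  qed
  then show "sphere (2::complex) 1 \<inter> sphere 4 1 = {3}"
    by (auto simp: sph simp del: mem_sphere mem_sphere_0)
  have False if "(Re z)\<^sup>2 + (Im z)\<^sup>2 = 1" "(4 - Re z)\<^sup>2 + (Im z)\<^sup>2 = 1" for z
  proof -
    have "Re z = 2" using that by (simp add: power2_eq_square algebra_simps)
    then show ?thesis using that zero_le_power2[of "Im z"] by simp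
  qed
  then show "sphere (0::complex) 1 \<inter> sphere 4 1 = {}"
    by (auto simp: sph simp del: mem_sphere mem_sphere_0)
qed

text \<open>Liouville tori are the connected components of a regular common level of the integrals.
  Since \<open>p\<close> is required to be a regular value, the tori are smoothly embedded surfaces, although
  only a homeomorphism is mentioned. The finite factor carries the discrete topology.\<close>

definition liouville_tori :: "real \<Rightarrow> nat \<Rightarrow> real \<times> real \<Rightarrow> bool" where
  "liouville_tori c n p \<longleftrightarrow>
     p \<notin> bifurcation_diagram c \<and>
     integral_surface c p homeomorphic ({1..n} \<times> (circle \<times> circle))"

text \<open>The two sides of an open arc: removing \<open>C\<close> from some open neighbourhood of \<open>C\<close> leaves
  two disjoint connected open sets, each of which accumulates at every point of \<open>C\<close>.\<close>

definition sides_of :: "'a::topological_space set \<Rightarrow> 'a set \<Rightarrow> 'a set \<Rightarrow> bool" where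
  "sides_of C U V \<longleftrightarrow>
     open U \<and> open V \<and> connected U \<and> connected V \<and>
     U \<inter> V = {} \<and> C \<inter> (U \<union> V) = {} \<and> open (C \<union> U \<union> V) \<and>
     C \<subseteq> closure U \<and> C \<subseteq> closure V"

end

theory Submission
  imports Defs
begin

text \<open>With \<open>z\<^sub>j = x\<^sub>j + i y\<^sub>j\<close>, the quotient of a level \<open>(f, h)\<close> by the rotations is the plane curve
  \<open>Y\<^sup>2 = G(X)\<close> in the invariants \<open>X = |z\<^sub>1|\<^sup>2 - |z\<^sub>2|\<^sup>2\<close> and \<open>Y = 2 Im (z\<^sub>2 cnj z\<^sub>1)\<close>; here
  \<open>G\<close> is even, and on \<open>X \<ge> 0\<close> it is a function \<open>b\<close> of \<open>d = |z\<^sub>1 - z\<^sub>2|\<^sup>2\<close>, which decreases in \<open>X\<close>.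
  The circle bundle is trivial, because the phase of \<open>z\<^sub>1 - z\<^sub>2\<close> is defined everywhere, so the
  topology is read off the intervals on which \<open>G\<close> is nonnegative.

  Since \<open>b''\<close> is strictly increasing, Rolle's theorem bounds the number of zeros of \<open>b\<close> by three,
  with multiplicity. Between \<open>A\<close> and \<open>B\<close> on \<open>\<gamma>\<^sub>2\<close> the function \<open>b\<close> has a simple zero followed by a double zero
  that is a local minimum: the two outer intervals touch the middle one. Lowering \<open>h\<close> splits the
  double zero (three intervals, hence three tori), and raising \<open>h\<close> removes it (one interval).
  Critical points of the momentum map correspond to multiple zeros of \<open>b\<close> and to \<open>X = Y = 0\<close>.
  Finally, \<open>f\<close> is strictly increasing along the arc, so the arc is a graph over \<open>f\<close> and its sides are
  the parts of a vertical strip below and above it.\<close>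

section \<open>Double covers of line segments\<close>

text \<open>Where \<open>\<phi>\<close> vanishes the product is squeezed to 0, since the sign has
  modulus at most 1 and \<open>g\<close> tends to 0. This makes it harmless that a map of double
  covers keeps only the sign of the second coordinate.\<close>

lemma continuous_on_sgn_mult:
  fixes \<phi> g :: "'a::topological_space \<Rightarrow> real"
  assumes "continuous_on S \<phi>" "continuous_on S g"
    and zero: "\<And>x. x \<in> S \<Longrightarrow> \<phi> x = 0 \<Longrightarrow> g x = 0"
  shows "continuous_on S (\<lambda>x. sgn (\<phi> x) * g x)"
  unfolding continuous_on_def
proof
  fix x assume x: "x \<in> S"
  have \<phi>: "(\<phi> \<longlongrightarrow> \<phi> x) (at x within S)" and g: "(g \<longlongrightarrow> g x) (at x within S)"
    using assms x by (auto simp: continuous_on_def)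
  show "((\<lambda>x. sgn (\<phi> x) * g x) \<longlongrightarrow> sgn (\<phi> x) * g x) (at x within S)"
  proof (cases "\<phi> x = 0")
    case True
    then have "(g \<longlongrightarrow> 0) (at x within S)"
      using g zero x by simp
    then have "((\<lambda>x. sgn (\<phi> x) * g x) \<longlongrightarrow> 0) (at x within S)"
      by (rule Lim_null_comparison[rotated, OF tendsto_norm_zero])
        (auto simp: abs_mult sgn_if intro!: always_eventually)
    then show ?thesis using True by simp
  next
    case False
    then show ?thesis by (intro tendsto_intros \<phi> g)
  qed
qed

text \<open>The base type is arbitrary so that an interval and the disjoint union
  \<open>{1..3} \<times> {-1..1}\<close> of three intervals can both serve as bases.\<close>

definition double_cover :: "'a set \<Rightarrow> ('a \<Rightarrow> real) \<Rightarrow> ('a \<times> real) set" where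
  "double_cover S G = {(x, y). x \<in> S \<and> y\<^sup>2 = G x}"

lemma compact_double_cover:
  fixes S :: "'a::topological_space set"
  assumes "compact S" "continuous_on S G" "\<And>x. x \<in> S \<Longrightarrow> G x \<ge> 0"
  shows "compact (double_cover S G)"
proof -
  have "double_cover S G = (\<lambda>(x, \<sigma>). (x, \<sigma> * sqrt (G x))) ` (S \<times> {-1, 1})"
    (is "_ = ?\<Phi> ` ?T")
  proof
    show "?\<Phi> ` ?T \<subseteq> double_cover S G"
      using assms(3) by (auto simp: double_cover_def)
    show "double_cover S G \<subseteq> ?\<Phi> ` ?T"
    proof (clarsimp simp: double_cover_def)
      fix x y assume "x \<in> S" "y\<^sup>2 = G x"
      then have "y = sqrt (G x) \<or> y = - sqrt (G x)"
        by (metis abs_if minus_equation_iff real_sqrt_abs)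
      with \<open>x \<in> S\<close> show "(x, y) \<in> ?\<Phi> ` ?T"
        by (auto simp: image_iff)
    qed
  qed
  moreover have "compact ?T" using assms(1) by (intro compact_Times) auto
  moreover have "continuous_on ?T (\<lambda>z. (fst z, snd z * sqrt (G (fst z))))"
    by (intro continuous_intros continuous_on_compose2[OF assms(2)]) auto
  ultimately show ?thesis
    by (simp add: compact_continuous_image case_prod_unfold)
qed

text \<open>Only the zero set of the radicand matters: a base bijection that matches zeros lifts by
  keeping the sign of \<open>y\<close> and replacing its modulus by
  \<open>sqrt (K (\<phi> x))\<close>. Compactness of the source makes the inverse continuous. Hence
  every radicand below may be traded for a model with the same zeros.\<close>

lemma homeomorphic_double_cover:
  fixes S :: "'a::topological_space set" and T :: "'b::t2_space set"
  assumes "compact S" and contG: "continuous_on S G" "continuous_on T K"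
    and nonneg: "\<And>x. x \<in> S \<Longrightarrow> G x \<ge> 0" "\<And>x. x \<in> T \<Longrightarrow> K x \<ge> 0"
    and \<phi>: "continuous_on S \<phi>" "inj_on \<phi> S" "\<phi> ` S = T"
    and zeros: "\<And>x. x \<in> S \<Longrightarrow> G x = 0 \<longleftrightarrow> K (\<phi> x) = 0"
  shows "double_cover S G homeomorphic double_cover T K"
proof (rule homeomorphic_compact)
  let ?f = "\<lambda>z. (\<phi> (fst z), sgn (snd z) * sqrt (K (\<phi> (fst z))))"
  have dc: "fst z \<in> S" "(snd z)\<^sup>2 = G (fst z)" if "z \<in> double_cover S G" for z
    using that by (auto simp: double_cover_def)
  have sgn_cancel: "y = y'" if "y\<^sup>2 = y'\<^sup>2" "sgn y = sgn y'" for y y' :: real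
    using that by (auto simp: power2_eq_iff sgn_if split: if_splits)
  show "compact (double_cover S G)"
    using assms by (intro compact_double_cover)
  have 1: "continuous_on (double_cover S G) (\<lambda>z. \<phi> (fst z))"
    by (rule continuous_on_compose2[OF \<phi>(1)]) (use dc in \<open>auto intro!: continuous_intros\<close>)
  have 2: "continuous_on (double_cover S G) (\<lambda>z. sqrt (K (\<phi> (fst z))))"
    by (intro continuous_intros continuous_on_compose2[OF contG(2) 1]) (use \<phi>(3) dc in auto)
  show "continuous_on (double_cover S G) ?f"
  proof (rule continuous_on_Pair[OF 1 continuous_on_sgn_mult[OF _ 2]])
    show "sqrt (K (\<phi> (fst z))) = 0" if "z \<in> double_cover S G" "snd z = 0" for z
      using zeros[OF dc(1)[OF that(1)]] dc(2)[OF that(1)] that(2) by simp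
  qed (intro continuous_intros)
  show "inj_on ?f (double_cover S G)"
  proof (rule inj_onI)
    fix z z' assume z: "z \<in> double_cover S G" "z' \<in> double_cover S G" and eq: "?f z = ?f z'"
    have fst: "fst z = fst z'" using inj_onD[OF \<phi>(2)] eq dc(1)[OF z(1)] dc(1)[OF z(2)] by simp
    moreover have "snd z = snd z'"
    proof (cases "G (fst z) = 0")
      case True
      then show ?thesis using dc(2)[OF z(1)] dc(2)[OF z(2)] fst by simp
    next
      case False
      then have "K (\<phi> (fst z)) \<noteq> 0" using zeros dc(1)[OF z(1)] by blast
      then have "sgn (snd z) = sgn (snd z')" using eq fst by simp
      then show ?thesis using dc(2)[OF z(1)] dc(2)[OF z(2)] fst by (simp add: sgn_cancel)
    qed
    ultimately show "z = z'" by (simp add: prod_eq_iff)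
  qed
  show "?f ` double_cover S G = double_cover T K"
  proof
    show "?f ` double_cover S G \<subseteq> double_cover T K"
    proof
      fix w assume "w \<in> ?f ` double_cover S G"
      then obtain z where z: "z \<in> double_cover S G" "w = ?f z" by blast
      have "K (\<phi> (fst z)) \<ge> 0" "\<phi> (fst z) \<in> T" using nonneg \<phi>(3) dc(1)[OF z(1)] by auto
      moreover have "K (\<phi> (fst z)) = 0" if "snd z = 0"
        using zeros[of "fst z"] dc[OF z(1)] that by simp
      ultimately show "w \<in> double_cover T K"
        using z by (auto simp: double_cover_def power_mult_distrib sgn_if)
    qed
    show "double_cover T K \<subseteq> ?f ` double_cover S G"
    proof
      fix w assume "w \<in> double_cover T K"
      then obtain x where x: "x \<in> S" "fst w = \<phi> x" "(snd w)\<^sup>2 = K (\<phi> x)"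
        using \<phi>(3) by (auto simp: double_cover_def)
      \<comment> \<open>The preimage of \<open>w\<close> lies over \<open>x\<close> on the sheet
        with the sign of \<open>snd w\<close>.\<close>
      define z where "z = (x, sgn (snd w) * sqrt (G x))"
      have G0: "G x = 0" if "snd w = 0" using that x zeros by auto
      have "z \<in> double_cover S G"
        using x nonneg(1)[of x] G0 by (auto simp: z_def double_cover_def power_mult_distrib sgn_if)
      moreover have "G x > 0" if "snd w \<noteq> 0"
        using that x zeros[of x] nonneg(1)[of x] by (metis order_le_less zero_eq_power2)
      then have "sgn (snd z) = sgn (snd w)"
        by (cases "snd w = 0") (auto simp: z_def sgn_mult)
      moreover have "snd w = sgn (snd w) * sqrt (K (\<phi> x))"
        by (metis x(3) real_sqrt_abs sgn_mult_abs)
      ultimately show "w \<in> ?f ` double_cover S G"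
        using x by (intro image_eqI[of _ _ z]) (auto simp: prod_eq_iff z_def)
    qed
  qed
qed

section \<open>Circle and chain as double covers\<close>

lemma homeomorphic_double_cover_complex:
  "{z. Re z \<in> S \<and> (Im z)\<^sup>2 = G (Re z)} homeomorphic double_cover S G"
proof -
  have "homeomorphism {z. Re z \<in> S \<and> (Im z)\<^sup>2 = G (Re z)} (double_cover S G)
      (\<lambda>z. (Re z, Im z)) (\<lambda>z. complex_of_real (fst z) + \<i> * complex_of_real (snd z))"
    by (rule homeomorphismI) (auto simp: double_cover_def complex_eq_iff intro!: continuous_intros)
  then show ?thesis by (auto simp: homeomorphic_def)
qed

lemma sphere_real_centre_iff:
  "z \<in> sphere (of_real a) 1 \<longleftrightarrow> \<bar>Re z - a\<bar> \<le> 1 \<and> (Im z)\<^sup>2 = 1 - (Re z - a)\<^sup>2"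
proof -
  have "z \<in> sphere (of_real a) 1 \<longleftrightarrow> (Re z - a)\<^sup>2 + (Im z)\<^sup>2 = 1"
    by (simp add: dist_norm cmod_def power2_commute)
  moreover have "\<bar>Re z - a\<bar> \<le> 1 \<longleftrightarrow> (Re z - a)\<^sup>2 \<le> 1"
    by (simp add: abs_square_le_1)
  moreover have "(Im z)\<^sup>2 \<ge> 0" by simp
  ultimately show ?thesis by linarith
qed

lemma circle_homeomorphic_double_cover:
  "circle homeomorphic double_cover {-1..1} (\<lambda>x. 1 - x\<^sup>2)"
proof -
  have "circle = {z. Re z \<in> {-1..1} \<and> (Im z)\<^sup>2 = 1 - (Re z)\<^sup>2}"
    unfolding set_eq_iff mem_Collect_eq sphere_real_centre_iff[of _ 0, unfolded of_real_0]
    by (auto simp: abs_le_iff)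
  then show ?thesis
    using homeomorphic_double_cover_complex[of "{-1..1}" "\<lambda>x. 1 - x\<^sup>2"] by (rule ssubst)
qed

text \<open>The three parabolas through the diameters of the circles are glued by \<^const>\<open>max\<close>:
  off its own diameter each of them is negative.\<close>

definition chain_height :: "real \<Rightarrow> real" where
  "chain_height x = max (1 - x\<^sup>2) (max (1 - (x - 2)\<^sup>2) (1 - (x - 4)\<^sup>2))"

lemma chain_height_eq:
  "x \<in> {-1..1} \<Longrightarrow> chain_height x = 1 - x\<^sup>2"
  "x \<in> {1..3} \<Longrightarrow> chain_height x = 1 - (x - 2)\<^sup>2"
  "x \<in> {3..5} \<Longrightarrow> chain_height x = 1 - (x - 4)\<^sup>2"
  by (simp_all add: chain_height_def max_def power2_eq_square algebra_simps)

lemma three_circle_chain_homeomorphic_double_cover: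
  "three_circle_chain homeomorphic double_cover {-1..5} chain_height"
proof -
  note sph = sphere_real_centre_iff[of _ 0, unfolded of_real_0]
    sphere_real_centre_iff[of _ 2, unfolded of_real_numeral]
    sphere_real_centre_iff[of _ 4, unfolded of_real_numeral]
  have "z \<in> three_circle_chain \<longleftrightarrow> Re z \<in> {-1..5} \<and> (Im z)\<^sup>2 = chain_height (Re z)" for z
  proof -
    have "\<bar>Re z\<bar> \<le> 1 \<longleftrightarrow> Re z \<in> {-1..1}" "\<bar>Re z - 2\<bar> \<le> 1 \<longleftrightarrow> Re z \<in> {1..3}"
      "\<bar>Re z - 4\<bar> \<le> 1 \<longleftrightarrow> Re z \<in> {3..5}" by auto
    moreover have "Re z \<in> {-1..5} \<longleftrightarrow> Re z \<in> {-1..1} \<or> Re z \<in> {1..3} \<or> Re z \<in> {3..5}" by auto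
    ultimately show ?thesis
      unfolding three_circle_chain_def Un_iff sph using chain_height_eq[of "Re z"] by auto
  qed
  then have "three_circle_chain = {z. Re z \<in> {-1..5} \<and> (Im z)\<^sup>2 = chain_height (Re z)}"
    by blast
  then show ?thesis
    using homeomorphic_double_cover_complex[of "{-1..5}" chain_height] by (rule ssubst)
qed

section \<open>Rearranging product spaces\<close>

lemma homeomorphic_Times_cong:
  fixes A :: "'a::topological_space set" and B :: "'b::topological_space set"
    and A' :: "'c::topological_space set" and B' :: "'d::topological_space set"
  assumes "A homeomorphic A'" "B homeomorphic B'"
  shows "A \<times> B homeomorphic A' \<times> B'"
proof -
  have map_prod: "continuous_on (P \<times> Q) (\<lambda>z. (f (fst z), g (snd z)))"
    if "continuous_on P f" "continuous_on Q g"
    for P :: "'p::topological_space set" and Q :: "'q::topological_space set"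
      and f :: "'p \<Rightarrow> 'r::topological_space" and g :: "'q \<Rightarrow> 's::topological_space"
    by (intro continuous_on_Pair continuous_on_compose2[OF that(1)] continuous_on_compose2[OF that(2)]
        continuous_intros) auto
  obtain f g f' g' where "homeomorphism A A' f g" "homeomorphism B B' f' g'"
    using assms by (auto simp: homeomorphic_def)
  then have "homeomorphism (A \<times> B) (A' \<times> B')
      (\<lambda>z. (f (fst z), f' (snd z))) (\<lambda>z. (g (fst z), g' (snd z)))"
    by (intro homeomorphismI map_prod) (auto simp: homeomorphism_def)
  then show ?thesis by (auto simp: homeomorphic_def)
qed

text \<open>Moving the finite factor into the base allows three circles to be compared with a level
  curve through a single map of bases.\<close>

lemma Times_double_cover_homeomorphic:
  "N \<times> double_cover S G homeomorphic double_cover (N \<times> S) (\<lambda>z. G (snd z))"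
proof -
  have "homeomorphism (N \<times> double_cover S G) (double_cover (N \<times> S) (\<lambda>z. G (snd z)))
      (\<lambda>z. ((fst z, fst (snd z)), snd (snd z))) (\<lambda>z. (fst (fst z), (snd (fst z), snd z)))"
    by (rule homeomorphismI) (auto simp: double_cover_def intro!: continuous_intros)
  then show ?thesis by (auto simp: homeomorphic_def)
qed

lemma Times_swap_homeomorphic:
  "A \<times> (B \<times> C) homeomorphic B \<times> (A \<times> C)"
proof -
  have "homeomorphism (A \<times> (B \<times> C)) (B \<times> (A \<times> C))
      (\<lambda>z. (fst (snd z), (fst z, snd (snd z)))) (\<lambda>z. (fst (snd z), (fst z, snd (snd z))))"
    by (rule homeomorphismI) (auto intro!: continuous_intros)
  then show ?thesis by (auto simp: homeomorphic_def)
qed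

section \<open>The radicand of the reduced level curve\<close>

text \<open>Write \<open>z\<^sub>j = x\<^sub>j + i y\<^sub>j\<close>, \<open>d = |z\<^sub>1 - z\<^sub>2|\<^sup>2\<close>, \<open>X = |z\<^sub>1|\<^sup>2 - |z\<^sub>2|\<^sup>2\<close>, \<open>Y = 2 Im (z\<^sub>2 cnj z\<^sub>1)\<close> and \<open>k = 4 exp (2 h)\<close>.
  On the level \<open>(f, h)\<close> one has \<open>X\<^sup>2 + Y\<^sup>2 = 2 f d - d\<^sup>2\<close> and \<open>X\<^sup>2 = (2 - f)\<^sup>2 - k d powr c\<close>, so that
  \<open>Y\<^sup>2\<close> is the following function of \<open>d\<close>.\<close>

definition ysq :: "real \<Rightarrow> real \<Rightarrow> real \<Rightarrow> real \<Rightarrow> real" where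
  "ysq c f k d = 2 * f * d - d\<^sup>2 - (2 - f)\<^sup>2 + k * d powr c"

definition dysq :: "real \<Rightarrow> real \<Rightarrow> real \<Rightarrow> real \<Rightarrow> real" where
  "dysq c f k d = 2 * f - 2 * d + k * c * d powr (c - 1)"

definition ddysq :: "real \<Rightarrow> real \<Rightarrow> real \<Rightarrow> real" where
  "ddysq c k d = k * c * (c - 1) * d powr (c - 2) - 2"

lemma ysq_has_derivative:
  "d > 0 \<Longrightarrow> (ysq c f k has_real_derivative dysq c f k d) (at d)"
  unfolding ysq_def dysq_def
  by (rule derivative_eq_intros refl has_real_derivative_powr | assumption)+ simp

lemma dysq_has_derivative:
  "d > 0 \<Longrightarrow> (dysq c f k has_real_derivative ddysq c k d) (at d)"
  unfolding dysq_def ddysq_def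
  by (rule derivative_eq_intros refl has_real_derivative_powr | assumption)+ simp

lemma continuous_on_ysq: "c > 0 \<Longrightarrow> continuous_on {0..} (ysq c f k)"
  unfolding ysq_def by (intro continuous_intros continuous_on_powr') auto

text \<open>Since \<open>0 powr c = 0\<close>, the radicand starts negative whenever
  \<open>f < 2\<close>; this is the left anchor of every intermediate value argument.\<close>

lemma ysq_zero: "ysq c f k 0 = - (2 - f)\<^sup>2"
  by (simp add: ysq_def)

section \<open>Counting zeros by Rolle's theorem\<close>

lemma ysq_root_Rolle:
  assumes "0 < a" "a < b" "ysq c f k a = ysq c f k b"
  shows "\<exists>z. a < z \<and> z < b \<and> dysq c f k z = 0"
  using MVT2[of a b "ysq c f k" "dysq c f k"] assms ysq_has_derivative[of _ c f k] by auto

lemma dysq_root_Rolle: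
  assumes "0 < a" "a < b" "dysq c f k a = dysq c f k b"
  shows "\<exists>z. a < z \<and> z < b \<and> ddysq c k z = 0"
  using MVT2[of a b "dysq c f k" "ddysq c k"] assms dysq_has_derivative[of _ c f k] by auto

context
  fixes c k :: real
  assumes c: "c > 2" and k: "k > 0"
begin

text \<open>For \<open>c > 2\<close> and \<open>k > 0\<close> both the coefficient and the exponent
  \<open>c - 2\<close> are positive. All bounds on numbers of zeros rest on this.\<close>

lemma ddysq_strict_mono: "0 < a \<Longrightarrow> a < b \<Longrightarrow> ddysq c k a < ddysq c k b"
  unfolding ddysq_def using c k by (simp add: powr_less_mono2)

text \<open>Three zeros would give, by Rolle twice, two distinct zeros of the strictly increasing
  second derivative.\<close>

lemma dysq_no_three_zeros:
  assumes "0 < x" "x < y" "y < z" "dysq c f k x = 0" "dysq c f k y = 0" "dysq c f k z = 0"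
  shows False
proof -
  obtain u where "x < u" "u < y" "ddysq c k u = 0"
    using dysq_root_Rolle[of x y c f k] assms by auto
  moreover obtain v where "y < v" "v < z" "ddysq c k v = 0"
    using dysq_root_Rolle[of y z c f k] assms by auto
  ultimately show False using ddysq_strict_mono[of u v] assms by simp
qed

text \<open>The gaps between three zeros already contain two zeros of the derivative. A fourth zero,
  or a multiple one, would produce a third.\<close>

lemma ysq_three_zeros:
  assumes e: "0 < e1" "e1 < e2" "e2 < e3"
    and z: "ysq c f k e1 = 0" "ysq c f k e2 = 0" "ysq c f k e3 = 0"
    and d: "d > 0" "ysq c f k d = 0"
  shows "d \<in> {e1, e2, e3} \<and> dysq c f k d \<noteq> 0"
proof -
  obtain u where u: "e1 < u" "u < e2" "dysq c f k u = 0"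
    using ysq_root_Rolle[of e1 e2 c f k] assms by auto
  obtain v where v: "e2 < v" "v < e3" "dysq c f k v = 0"
    using ysq_root_Rolle[of e2 e3 c f k] assms by auto
  have mem: "d \<in> {e1, e2, e3}"
  proof (rule ccontr)
    assume n: "d \<notin> {e1, e2, e3}"
    consider "d < e1" | "e1 < d" "d < e2" | "e2 < d" "d < e3" | "e3 < d" using n by force
    then show False
    proof cases
      case 1
      then obtain w where "d < w" "w < e1" "dysq c f k w = 0"
        using ysq_root_Rolle[of d e1 c f k] assms by auto
      then show False using dysq_no_three_zeros[of w u v f] u v d by linarith
    next
      case 2
      obtain w where "e1 < w" "w < d" "dysq c f k w = 0"
        using ysq_root_Rolle[of e1 d c f k] assms 2 by auto
      moreover obtain w' where "d < w'" "w' < e2" "dysq c f k w' = 0"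
        using ysq_root_Rolle[of d e2 c f k] assms 2 by auto
      ultimately show False using dysq_no_three_zeros[of w w' v f] v e by linarith
    next
      case 3
      obtain w where "e2 < w" "w < d" "dysq c f k w = 0"
        using ysq_root_Rolle[of e2 d c f k] assms 3 by auto
      moreover obtain w' where "d < w'" "w' < e3" "dysq c f k w' = 0"
        using ysq_root_Rolle[of d e3 c f k] assms 3 by auto
      ultimately show False using dysq_no_three_zeros[of u w w' f] u e by linarith
    next
      case 4
      then obtain w where "e3 < w" "w < d" "dysq c f k w = 0"
        using ysq_root_Rolle[of e3 d c f k] assms by auto
      then show False using dysq_no_three_zeros[of u v w f] u v e by linarith
    qed
  qed
  moreover have "dysq c f k d \<noteq> 0"
  proof
    assume 0: "dysq c f k d = 0"
    consider "d = e1" | "d = e2" | "d = e3" using mem by blast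
    then show False
    proof cases
      case 1
      then show False using dysq_no_three_zeros[of e1 u v f] 0 u v e by simp
    next
      case 2
      then show False using dysq_no_three_zeros[of u e2 v f] 0 u v e by simp
    next
      case 3
      then show False using dysq_no_three_zeros[of u v e3 f] 0 u v e by simp
    qed
  qed
  ultimately show ?thesis by blast
qed

text \<open>The derivative vanishes at the double zero \<open>e0\<close> and, by Rolle, at some
  \<open>u\<close> between \<open>e1\<close> and \<open>e0\<close>. Another zero of
  \<open>ysq\<close>, or a zero of the derivative up to \<open>e1\<close>, would be one too
  many.\<close>

lemma ysq_double_zero:
  assumes e: "0 < e1" "e1 < e0"
    and z: "ysq c f k e1 = 0" "ysq c f k e0 = 0" "dysq c f k e0 = 0"
  shows "d > 0 \<Longrightarrow> ysq c f k d = 0 \<Longrightarrow> d \<in> {e1, e0}"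
    and "0 < d \<Longrightarrow> d \<le> e1 \<Longrightarrow> dysq c f k d \<noteq> 0"
proof -
  obtain u where u: "e1 < u" "u < e0" "dysq c f k u = 0"
    using ysq_root_Rolle[of e1 e0 c f k] assms by auto
  show "d \<in> {e1, e0}" if d: "d > 0" "ysq c f k d = 0"
  proof (rule ccontr)
    assume n: "d \<notin> {e1, e0}"
    consider "d < e1" | "e1 < d" "d < e0" | "e0 < d" using n by force
    then show False
    proof cases
      case 1
      then obtain w where "d < w" "w < e1" "dysq c f k w = 0"
        using ysq_root_Rolle[of d e1 c f k] assms d by auto
      then show False using dysq_no_three_zeros[of w u e0 f] u d z by linarith
    next
      case 2
      obtain w where "e1 < w" "w < d" "dysq c f k w = 0"
        using ysq_root_Rolle[of e1 d c f k] assms 2 d by auto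
      moreover obtain w' where "d < w'" "w' < e0" "dysq c f k w' = 0"
        using ysq_root_Rolle[of d e0 c f k] assms 2 d by auto
      ultimately show False using dysq_no_three_zeros[of w w' e0 f] z e by linarith
    next
      case 3
      then obtain w where "e0 < w" "w < d" "dysq c f k w = 0"
        using ysq_root_Rolle[of e0 d c f k] assms d by auto
      then show False using dysq_no_three_zeros[of u e0 w f] u e z by linarith
    qed
  qed
  show "dysq c f k d \<noteq> 0" if "0 < d" "d \<le> e1"
    using dysq_no_three_zeros[of d u e0 f] that u z by fastforce
qed

end

lemma continuous_no_zero_same_sign:
  fixes g :: "real \<Rightarrow> real"
  assumes "continuous_on S g" "is_interval S" "\<And>x. x \<in> S \<Longrightarrow> g x \<noteq> 0" "a \<in> S" "b \<in> S" "g a > 0"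
  shows "g b > 0"
proof (rule ccontr)
  assume "\<not> g b > 0"
  moreover have "connected (g ` S)"
    using assms by (intro connected_continuous_image) (auto simp: is_interval_connected)
  ultimately have "0 \<in> g ` S"
    using assms(4-6) connectedD_interval[of "g ` S" "g b" "g a" 0] by auto
  then show False using assms(3) by force
qed

lemma continuous_no_zero_same_sign':
  fixes g :: "real \<Rightarrow> real"
  assumes "continuous_on S g" "is_interval S" "\<And>x. x \<in> S \<Longrightarrow> g x \<noteq> 0" "a \<in> S" "b \<in> S" "g a < 0"
  shows "g b < 0"
  using continuous_no_zero_same_sign[of S "\<lambda>x. - g x" a b] assms continuous_on_minus by auto

section \<open>Reduction by the rotation symmetry\<close>

text \<open>The energy equation \<open>X\<^sup>2 = (2 - f)\<^sup>2 - k * d powr c\<close> solved for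
  \<open>d\<close>, so that the level curve becomes a double cover over the \<open>X\<close>
  axis.\<close>

definition separation_sq :: "real \<Rightarrow> real \<Rightarrow> real \<Rightarrow> real \<Rightarrow> real" where
  "separation_sq c f k X = (((2 - f)\<^sup>2 - X\<^sup>2) / k) powr (1 / c)"

lemma separation_sq_pos: "k > 0 \<Longrightarrow> \<bar>X\<bar> < 2 - f \<Longrightarrow> separation_sq c f k X > 0"
proof -
  assume "k > 0" "\<bar>X\<bar> < 2 - f"
  then have "X\<^sup>2 < (2 - f)\<^sup>2" using abs_le_square_iff[of "2 - f" X] by force
  with \<open>k > 0\<close> show ?thesis by (simp add: separation_sq_def)
qed

lemma separation_sq_ge_iff:
  assumes "k > 0" "c > 0" "\<bar>X\<bar> < 2 - f" "d > 0"
  shows "d \<le> separation_sq c f k X \<longleftrightarrow> X\<^sup>2 \<le> (2 - f)\<^sup>2 - k * d powr c"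
    and "d = separation_sq c f k X \<longleftrightarrow> X\<^sup>2 = (2 - f)\<^sup>2 - k * d powr c"
proof -
  let ?s = "separation_sq c f k X"
  have s: "?s > 0" using separation_sq_pos assms by simp
  have "X\<^sup>2 < (2 - f)\<^sup>2" using assms(3) abs_le_square_iff[of "2 - f" X] by force
  then have "k * ?s powr c = (2 - f)\<^sup>2 - X\<^sup>2"
    using assms by (simp add: separation_sq_def powr_powr)
  moreover have "d \<le> ?s \<longleftrightarrow> d powr c \<le> ?s powr c"
    using s assms by (meson powr_mono2 powr_less_mono2 less_imp_le not_le)
  then have "d \<le> ?s \<longleftrightarrow> k * d powr c \<le> k * ?s powr c"
    using assms by simp
  moreover have "d = ?s \<longleftrightarrow> d powr c = ?s powr c"
    using s assms by (metis linorder_neqE_linordered_idom powr_less_mono2 order_less_irrefl less_imp_le)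
  then have "d = ?s \<longleftrightarrow> k * d powr c = k * ?s powr c"
    using assms by simp
  ultimately show "d \<le> ?s \<longleftrightarrow> X\<^sup>2 \<le> (2 - f)\<^sup>2 - k * d powr c"
    and "d = ?s \<longleftrightarrow> X\<^sup>2 = (2 - f)\<^sup>2 - k * d powr c"
    by auto
qed

lemma continuous_on_separation_sq:
  assumes "k > 0" "\<And>x. x \<in> S \<Longrightarrow> \<bar>g x\<bar> < 2 - f" "continuous_on S g"
  shows "continuous_on S (\<lambda>x. separation_sq c f k (g x))"
proof -
  have "((2 - f)\<^sup>2 - (g x)\<^sup>2) / k \<noteq> 0" if "x \<in> S" for x
    using assms(1) assms(2)[OF that] abs_le_square_iff[of "2 - f" "g x"] by force
  then show ?thesis
    unfolding separation_sq_def using assms by (intro continuous_intros) auto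
qed

text \<open>Put m_j = 1 - |z_j|^2. Exponentiating the energy equation gives m_1 m_2 = exp(2h) d^c.
  On the level of \<open>f\<close> one has m_1 + m_2 = 2 - f and m_2 - m_1 = X, so 4 m_1 m_2 = (2 -
  f)^2 - X^2, and both vortices lie in the open disc exactly when |X| < 2 - f.\<close>

lemma integral_surface_iff:
  fixes x1 y1 x2 y2 f h c :: real
  defines "d \<equiv> (x2 - x1)\<^sup>2 + (y2 - y1)\<^sup>2" and "X \<equiv> x1\<^sup>2 + y1\<^sup>2 - (x2\<^sup>2 + y2\<^sup>2)"
    and "k \<equiv> 4 * exp (2 * h)"
  shows "(x1, y1, x2, y2) \<in> integral_surface c (f, h) \<longleftrightarrow>
    x1\<^sup>2 + y1\<^sup>2 + x2\<^sup>2 + y2\<^sup>2 = f \<and> d > 0 \<and> \<bar>X\<bar> < 2 - f \<and> (2 - f)\<^sup>2 - X\<^sup>2 = k * d powr c"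
proof -
  define m1 m2 where m: "m1 = 1 - (x1\<^sup>2 + y1\<^sup>2)" "m2 = 1 - (x2\<^sup>2 + y2\<^sup>2)"
  have d0: "d > 0 \<longleftrightarrow> \<not> (x1 = x2 \<and> y1 = y2)"
    unfolding d_def by (simp add: sum_power2_gt_zero_iff) auto
  have H: "1/2 * ln m1 + 1/2 * ln m2 - c/2 * ln d = h \<longleftrightarrow> m1 * m2 = exp (2 * h) * d powr c"
    if "m1 > 0" "m2 > 0" "d > 0"
  proof -
    have "1/2 * ln m1 + 1/2 * ln m2 - c/2 * ln d = h \<longleftrightarrow> ln (m1 * m2) = ln (exp (2 * h) * d powr c)"
      using that by (simp add: ln_mult ln_powr) linarith
    then show ?thesis using that by simp
  qed
  have "(x1, y1, x2, y2) \<in> integral_surface c (f, h) \<longleftrightarrow>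
      x1\<^sup>2 + y1\<^sup>2 + x2\<^sup>2 + y2\<^sup>2 = f \<and> m1 > 0 \<and> m2 > 0 \<and> d > 0 \<and>
      1/2 * ln m1 + 1/2 * ln m2 - c/2 * ln d = h"
    using d0 by (auto simp: integral_surface_def phase_space_def momentum_map_def
        vorticity_moment_def hamiltonian_def m d_def)
  also have "\<dots> \<longleftrightarrow> x1\<^sup>2 + y1\<^sup>2 + x2\<^sup>2 + y2\<^sup>2 = f \<and> m1 > 0 \<and> m2 > 0 \<and> d > 0 \<and>
      m1 * m2 = exp (2 * h) * d powr c"
    using H by blast
  also have "\<dots> \<longleftrightarrow> x1\<^sup>2 + y1\<^sup>2 + x2\<^sup>2 + y2\<^sup>2 = f \<and> d > 0 \<and> \<bar>X\<bar> < 2 - f \<and>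
      (2 - f)\<^sup>2 - X\<^sup>2 = k * d powr c"
  proof (rule conj_cong[OF refl])
    assume f: "x1\<^sup>2 + y1\<^sup>2 + x2\<^sup>2 + y2\<^sup>2 = f"
    have eq: "2 - f = m1 + m2" "X = m2 - m1" using f by (auto simp: m X_def)
    have "\<bar>X\<bar> < 2 - f \<longleftrightarrow> m1 > 0 \<and> m2 > 0" "(2 - f)\<^sup>2 - X\<^sup>2 = 4 * (m1 * m2)"
      unfolding eq by (auto simp: power2_eq_square algebra_simps)
    then show "(m1 > 0 \<and> m2 > 0 \<and> d > 0 \<and> m1 * m2 = exp (2 * h) * d powr c) \<longleftrightarrow>
        (d > 0 \<and> \<bar>X\<bar> < 2 - f \<and> (2 - f)\<^sup>2 - X\<^sup>2 = k * d powr c)"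
      by (auto simp: k_def)
  qed
  finally show ?thesis .
qed

text \<open>Rotating by the phase of \<open>z\<^sub>1 - z\<^sub>2\<close>, which never vanishes, trivialises the circle bundle over the
  orbit space.\<close>

lemma integral_surface_homeomorphic:
  fixes c f h :: real
  defines "k \<equiv> 4 * exp (2 * h)"
  assumes c: "c > 0"
    and S: "\<And>X. X \<in> S \<longleftrightarrow> \<bar>X\<bar> < 2 - f \<and> ysq c f k (separation_sq c f k X) \<ge> 0"
  shows "integral_surface c (f, h) homeomorphic
    circle \<times> double_cover S (\<lambda>X. ysq c f k (separation_sq c f k X))"
    (is "_ homeomorphic circle \<times> ?R")
proof -
  have k: "k > 0" by (simp add: k_def)
  define D where "D = separation_sq c f k"
  \<comment> \<open>In complex notation z_1 = e (X + D + iY) / (2 sqrt D) and z_2 = e (X - D + iY) /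
    (2 sqrt D), with D = D(X). Thus z_1 - z_2 = e sqrt D, and \<open>e\<close> is the phase of the
    difference. The map \<open>\<psi>\<close> reads off this phase and the two invariants.\<close>
  define \<phi> :: "complex \<times> real \<times> real \<Rightarrow> real \<times> real \<times> real \<times> real" where "\<phi> = (\<lambda>(e, X, Y).
      ((Re e * (X + D X) - Im e * Y) / (2 * sqrt (D X)), (Im e * (X + D X) + Re e * Y) / (2 * sqrt (D X)),
       (Re e * (X - D X) - Im e * Y) / (2 * sqrt (D X)), (Im e * (X - D X) + Re e * Y) / (2 * sqrt (D X))))"
  define \<psi> :: "real \<times> real \<times> real \<times> real \<Rightarrow> complex \<times> real \<times> real" where "\<psi> = (\<lambda>(x1, y1, x2, y2).
      (complex_of_real ((x1 - x2) / sqrt ((x2 - x1)\<^sup>2 + (y2 - y1)\<^sup>2))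
         + \<i> * complex_of_real ((y1 - y2) / sqrt ((x2 - x1)\<^sup>2 + (y2 - y1)\<^sup>2)),
       x1\<^sup>2 + y1\<^sup>2 - (x2\<^sup>2 + y2\<^sup>2), 2 * (x1 * y2 - y1 * x2)))"
  have R: "(X, Y) \<in> ?R \<longleftrightarrow> \<bar>X\<bar> < 2 - f \<and> Y\<^sup>2 = ysq c f k (D X)" for X Y
    unfolding double_cover_def D_def mem_Collect_eq case_prod_conv S by (metis zero_le_power2)
  have \<phi>: "\<phi> (e, X, Y) \<in> integral_surface c (f, h) \<and> \<psi> (\<phi> (e, X, Y)) = (e, X, Y)"
    if e: "e \<in> circle" and XY: "(X, Y) \<in> ?R" for e X Y
  proof -
    define a b d r where "a = Re e" and "b = Im e" and "d = D X" and "r = sqrt d"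
    have X: "\<bar>X\<bar> < 2 - f" and Y: "Y\<^sup>2 = ysq c f k d" using XY R by (auto simp: d_def)
    have d: "d > 0" using separation_sq_pos k X by (simp add: d_def D_def)
    then have r: "r > 0" "d = r\<^sup>2" by (auto simp: r_def)
    have Xd: "X\<^sup>2 = (2 - f)\<^sup>2 - k * d powr c"
      using separation_sq_ge_iff(2)[OF k c X d] by (simp add: d_def D_def)
    have XYd: "X\<^sup>2 + Y\<^sup>2 = 2 * f * d - d\<^sup>2" using Xd Y by (simp add: ysq_def)
    have ab: "a\<^sup>2 + b\<^sup>2 = 1" using e by (simp add: a_def b_def cmod_def)
    define x1 y1 x2 y2 where xy: "x1 = (a * (X + d) - b * Y) / (2 * r)"
      "y1 = (b * (X + d) + a * Y) / (2 * r)" "x2 = (a * (X - d) - b * Y) / (2 * r)"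
      "y2 = (b * (X - d) + a * Y) / (2 * r)"
    have \<phi>eq: "\<phi> (e, X, Y) = (x1, y1, x2, y2)"
      by (simp add: \<phi>_def xy a_def b_def r_def d_def)
    have n1: "x1\<^sup>2 + y1\<^sup>2 = ((X + d)\<^sup>2 + Y\<^sup>2) / (4 * d)"
    proof -
      have "x1\<^sup>2 + y1\<^sup>2 = (a\<^sup>2 + b\<^sup>2) * ((X + d)\<^sup>2 + Y\<^sup>2) / (4 * r\<^sup>2)"
        unfolding xy by (simp add: power_divide add_divide_distrib[symmetric] power_mult_distrib)
          (simp add: power2_eq_square algebra_simps)
      then show ?thesis using ab r by simp
    qed
    have n2: "x2\<^sup>2 + y2\<^sup>2 = ((X - d)\<^sup>2 + Y\<^sup>2) / (4 * d)"
    proof -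
      have "x2\<^sup>2 + y2\<^sup>2 = (a\<^sup>2 + b\<^sup>2) * ((X - d)\<^sup>2 + Y\<^sup>2) / (4 * r\<^sup>2)"
        unfolding xy by (simp add: power_divide add_divide_distrib[symmetric] power_mult_distrib)
          (simp add: power2_eq_square algebra_simps)
      then show ?thesis using ab r by simp
    qed
    have "x1 - x2 = a * (d / r)" "y1 - y2 = b * (d / r)"
      unfolding xy using r(1) by (simp_all add: field_simps)
    moreover have "d / r = r" using r by (simp add: power2_eq_square)
    ultimately have diff: "x1 - x2 = a * r" "y1 - y2 = b * r" by simp_all
    have "(x2 - x1)\<^sup>2 + (y2 - y1)\<^sup>2 = (a\<^sup>2 + b\<^sup>2) * r\<^sup>2"
      using diff by (simp add: power2_commute[of x2] power2_commute[of y2] power_mult_distrib algebra_simps)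
    then have dist: "(x2 - x1)\<^sup>2 + (y2 - y1)\<^sup>2 = d" using ab r by simp
    have sum: "x1\<^sup>2 + y1\<^sup>2 + (x2\<^sup>2 + y2\<^sup>2) = f"
    proof -
      have "(X + d)\<^sup>2 + Y\<^sup>2 + ((X - d)\<^sup>2 + Y\<^sup>2) = f * (4 * d)"
        using XYd by (simp add: power2_eq_square algebra_simps)
      then show ?thesis unfolding n1 n2 add_divide_distrib[symmetric] using d by simp
    qed
    have diffX: "x1\<^sup>2 + y1\<^sup>2 - (x2\<^sup>2 + y2\<^sup>2) = X"
    proof -
      have "(X + d)\<^sup>2 + Y\<^sup>2 - ((X - d)\<^sup>2 + Y\<^sup>2) = X * (4 * d)"
        by (simp add: power2_eq_square algebra_simps)
      then show ?thesis unfolding n1 n2 diff_divide_distrib[symmetric] using d by simp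
    qed
    have diffY: "2 * (x1 * y2 - y1 * x2) = Y"
    proof -
      have quot: "p / s * (q / s) - u / s * (v / s) = (p * q - u * v) / s\<^sup>2" for p q u v s :: real
        by (simp add: diff_divide_distrib power2_eq_square)
      have num: "(a * (X + d) - b * Y) * (b * (X - d) + a * Y) - (b * (X + d) + a * Y) * (a * (X - d) - b * Y)
          = (a\<^sup>2 + b\<^sup>2) * (2 * d * Y)"
        by (simp add: power2_eq_square algebra_simps)
      have "x1 * y2 - y1 * x2 = 2 * d * Y / (2 * r)\<^sup>2"
        unfolding xy quot num ab by simp
      then show ?thesis using ab r by simp
    qed
    have "\<phi> (e, X, Y) \<in> integral_surface c (f, h)"
      unfolding \<phi>eq integral_surface_iff dist diffX using sum d X Xd by (simp add: k_def)
    moreover have "\<psi> (\<phi> (e, X, Y)) = (e, X, Y)"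
      unfolding \<phi>eq \<psi>_def case_prod_conv dist diffX diffY r_def[symmetric]
      using diff r by (simp add: a_def b_def complex_eq[symmetric])
    ultimately show ?thesis ..
  qed
  have \<psi>: "\<psi> \<zeta> \<in> circle \<times> ?R \<and> \<phi> (\<psi> \<zeta>) = \<zeta>" if \<zeta>: "\<zeta> \<in> integral_surface c (f, h)" for \<zeta>
  proof -
    obtain x1 y1 x2 y2 where \<zeta>eq: "\<zeta> = (x1, y1, x2, y2)" by (cases \<zeta>)
    define d X Y r where "d = (x2 - x1)\<^sup>2 + (y2 - y1)\<^sup>2" and "X = x1\<^sup>2 + y1\<^sup>2 - (x2\<^sup>2 + y2\<^sup>2)"
      and "Y = 2 * (x1 * y2 - y1 * x2)" and "r = sqrt d"
    have f: "x1\<^sup>2 + y1\<^sup>2 + x2\<^sup>2 + y2\<^sup>2 = f" and d: "d > 0" and X: "\<bar>X\<bar> < 2 - f"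
      and Xd: "(2 - f)\<^sup>2 - X\<^sup>2 = k * d powr c"
      using \<zeta> unfolding \<zeta>eq integral_surface_iff by (auto simp: d_def X_def k_def)
    have r: "r > 0" "r * r = d" using d by (auto simp: r_def)
    have D: "D X = d" using separation_sq_ge_iff(2)[OF k c X d] Xd by (simp add: D_def)
    \<comment> \<open>The number (z_1 + z_2) times the conjugate of z_1 - z_2 equals X + iY, and
      |z_1 + z_2|^2 = 2f - d.\<close>
    have "X\<^sup>2 + Y\<^sup>2 = 2 * f * d - d\<^sup>2"
      unfolding d_def X_def Y_def f[symmetric] by (simp add: power2_eq_square algebra_simps)
    then have XY: "(X, Y) \<in> ?R" unfolding R D using X Xd by (simp add: ysq_def)
    define a b where "a = (x1 - x2) / r" and "b = (y1 - y2) / r"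
    have "a\<^sup>2 + b\<^sup>2 = ((x1 - x2)\<^sup>2 + (y1 - y2)\<^sup>2) / r\<^sup>2"
      by (simp add: a_def b_def power_divide add_divide_distrib)
    also have "\<dots> = 1"
    proof -
      have "(x1 - x2)\<^sup>2 + (y1 - y2)\<^sup>2 = r\<^sup>2"
        using r(2) by (simp add: power2_eq_square[of r] d_def power2_commute)
      then show ?thesis using r(1) by simp
    qed
    finally have ab: "a\<^sup>2 + b\<^sup>2 = 1" .
    have \<psi>eq: "\<psi> \<zeta> = (complex_of_real a + \<i> * complex_of_real b, X, Y)"
      by (simp add: \<psi>_def \<zeta>eq a_def b_def X_def Y_def r_def d_def)
    have quot: "u / r * p - v / r * q = w * (2 * r)" if "u * p - v * q = w * (2 * d)" for u v w p q
    proof -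
      have "u / r * p - v / r * q = (u * p - v * q) / r" by (simp add: diff_divide_distrib)
      also have "\<dots> = w * (2 * r)" using r unfolding that by (simp add: field_simps)
      finally show ?thesis .
    qed
    \<comment> \<open>Real and imaginary parts of e (X + d + iY) = 2 r z_1 and e (X - d + iY) = 2 r
      z_2, where e = (z_1 - z_2) / r. The double negations bring all four into the form of
      \<open>quot\<close>.\<close>
    have "a * (X + d) - b * Y = x1 * (2 * r)" "b * (X + d) - (- a) * Y = y1 * (2 * r)"
      "a * (X - d) - b * Y = x2 * (2 * r)" "b * (X - d) - (- a) * Y = y2 * (2 * r)"
      unfolding a_def b_def minus_divide_left
      by (rule quot; simp add: X_def Y_def d_def power2_eq_square algebra_simps)+
    then have "\<phi> (\<psi> \<zeta>) = \<zeta>"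
      unfolding \<psi>eq \<phi>_def case_prod_conv D r_def[symmetric] using r by (simp add: \<zeta>eq)
    moreover have "\<psi> \<zeta> \<in> circle \<times> ?R"
      using XY ab unfolding \<psi>eq by (simp add: cmod_def)
    ultimately show ?thesis by simp
  qed
  have "homeomorphism (integral_surface c (f, h)) (circle \<times> ?R) \<psi> \<phi>"
  proof (rule homeomorphismI)
    have pos: "(x2 - x1)\<^sup>2 + (y2 - y1)\<^sup>2 > 0" if "(x1, y1, x2, y2) \<in> integral_surface c (f, h)"
      for x1 y1 x2 y2
      using that unfolding integral_surface_iff by blast
    show "continuous_on (integral_surface c (f, h)) \<psi>"
      unfolding \<psi>_def case_prod_unfold
      by (intro continuous_intros) (use pos in \<open>force simp: prod.collapse\<close>)+
    have Xb: "\<bar>fst (snd z)\<bar> < 2 - f" if "z \<in> circle \<times> ?R" for z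
      using that R by (metis mem_Times_iff prod.collapse)
    have "continuous_on (circle \<times> ?R) (\<lambda>z. D (fst (snd z)))"
      unfolding D_def by (rule continuous_on_separation_sq[OF k Xb]) (auto intro!: continuous_intros)
    moreover have "2 * sqrt (D (fst (snd z))) \<noteq> 0" if "z \<in> circle \<times> ?R" for z
      using separation_sq_pos[OF k Xb[OF that]] by (simp add: D_def less_imp_neq[symmetric])
    ultimately show "continuous_on (circle \<times> ?R) \<phi>"
      unfolding \<phi>_def case_prod_unfold
      by (intro continuous_intros) auto
    have \<phi>': "\<phi> z \<in> integral_surface c (f, h) \<and> \<psi> (\<phi> z) = z" if "z \<in> circle \<times> ?R" for z
      using \<phi>[of "fst z" "fst (snd z)" "snd (snd z)"] that by (simp add: mem_Times_iff)
    show "\<psi> ` integral_surface c (f, h) \<subseteq> circle \<times> ?R" using \<psi> by blast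
    show "\<phi> ` (circle \<times> ?R) \<subseteq> integral_surface c (f, h)" using \<phi>' by blast
    show "\<phi> (\<psi> \<zeta>) = \<zeta>" if "\<zeta> \<in> integral_surface c (f, h)" for \<zeta> using \<psi> that by blast
    show "\<psi> (\<phi> z) = z" if "z \<in> circle \<times> ?R" for z using \<phi>' that by blast
  qed
  then show ?thesis by (auto simp: homeomorphic_def)
qed

section \<open>Shape of the integral surfaces\<close>

text \<open>The value of \<open>|X|\<close> belonging to \<open>d\<close>.\<close>

definition half_width :: "real \<Rightarrow> real \<Rightarrow> real \<Rightarrow> real \<Rightarrow> real" where
  "half_width c f k d = sqrt ((2 - f)\<^sup>2 - k * d powr c)"

context
  fixes c f h k :: real
  assumes c: "c > 0" and f: "f < 2" and k_def: "k = 4 * exp (2 * h)"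
begin

lemma k_pos: "k > 0"
  by (simp add: k_def)

lemma half_width_less: "d > 0 \<Longrightarrow> half_width c f k d < 2 - f"
proof -
  assume "d > 0"
  then have "k * d powr c > 0" using k_pos by simp
  then show ?thesis using f unfolding half_width_def by (intro real_less_lsqrt) auto
qed

text \<open>The function \<open>sqrt\<close> is odd and strictly increasing on all of the reals, so
  the radicand may have any sign.\<close>

lemma half_width_strict_antimono: "0 < d \<Longrightarrow> d < d' \<Longrightarrow> half_width c f k d' < half_width c f k d"
  unfolding half_width_def using c k_pos by (simp add: powr_less_mono2)

text \<open>As \<open>d\<close> decreases when |X| grows, conditions on \<open>d\<close> turn into
  symmetric conditions on \<open>X\<close> with reversed inequalities. Positivity of
  \<open>half_width\<close> says that \<open>d\<close> is attained at two distinct values X and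
  -X.\<close>

lemma separation_sq_half_width_iff:
  assumes "\<bar>X\<bar> < 2 - f" "d > 0" "half_width c f k d > 0"
  shows "d \<le> separation_sq c f k X \<longleftrightarrow> \<bar>X\<bar> \<le> half_width c f k d"
    and "separation_sq c f k X \<le> d \<longleftrightarrow> half_width c f k d \<le> \<bar>X\<bar>"
    and "separation_sq c f k X = d \<longleftrightarrow> \<bar>X\<bar> = half_width c f k d"
proof -
  have pos: "(2 - f)\<^sup>2 - k * d powr c > 0" using assms(3) by (simp add: half_width_def)
  then have sq: "(half_width c f k d)\<^sup>2 = (2 - f)\<^sup>2 - k * d powr c" by (simp add: half_width_def)
  have "X\<^sup>2 \<le> (half_width c f k d)\<^sup>2 \<longleftrightarrow> \<bar>X\<bar> \<le> half_width c f k d"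
    using abs_le_square_iff[of X "half_width c f k d"] assms(3) by simp
  moreover have "X\<^sup>2 = (half_width c f k d)\<^sup>2 \<longleftrightarrow> \<bar>X\<bar> = half_width c f k d"
    using assms(3) by (auto simp: power2_eq_iff)
  ultimately show "d \<le> separation_sq c f k X \<longleftrightarrow> \<bar>X\<bar> \<le> half_width c f k d"
    and "separation_sq c f k X = d \<longleftrightarrow> \<bar>X\<bar> = half_width c f k d"
    using separation_sq_ge_iff[OF k_pos c assms(1,2)] sq by auto
  then show "separation_sq c f k X \<le> d \<longleftrightarrow> half_width c f k d \<le> \<bar>X\<bar>"
    by linarith
qed

lemma continuous_on_ysq_separation_sq:
  assumes "\<And>X. X \<in> S \<Longrightarrow> \<bar>X\<bar> < 2 - f"
  shows "continuous_on S (\<lambda>X. ysq c f k (separation_sq c f k X))"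
proof (rule continuous_on_compose2[OF continuous_on_ysq[OF c]])
  show "continuous_on S (separation_sq c f k)"
    using assms by (intro continuous_on_separation_sq[OF k_pos]) auto
  show "separation_sq c f k ` S \<subseteq> {0..}"
    using assms separation_sq_pos[OF k_pos] by (force simp: less_imp_le)
qed

text \<open>The condition \<open>e \<le> d\<close> cuts out one symmetric interval of
  \<open>X\<close> with zeros exactly at its ends; its double cover is a circle after rescaling to
  [-1, 1].\<close>

lemma integral_surface_one_torus:
  assumes e: "e > 0" "half_width c f k e > 0"
    and nonneg: "\<And>d. d > 0 \<Longrightarrow> ysq c f k d \<ge> 0 \<longleftrightarrow> e \<le> d"
    and zero: "\<And>d. d > 0 \<Longrightarrow> ysq c f k d = 0 \<longleftrightarrow> d = e"
  shows "integral_surface c (f, h) homeomorphic {1..1::nat} \<times> (circle \<times> circle)"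
proof -
  define m where "m = half_width c f k e"
  let ?K = "\<lambda>X. ysq c f k (separation_sq c f k X)"
  have m: "m > 0" "m < 2 - f" using e half_width_less by (auto simp: m_def)
  have S: "X \<in> {-m..m} \<longleftrightarrow> \<bar>X\<bar> < 2 - f \<and> ?K X \<ge> 0" for X
  proof -
    have "\<bar>X\<bar> < 2 - f \<Longrightarrow> ?K X \<ge> 0 \<longleftrightarrow> \<bar>X\<bar> \<le> m"
      using nonneg separation_sq_pos[OF k_pos] separation_sq_half_width_iff(1) e by (simp add: m_def)
    then show ?thesis using m by (auto simp: abs_le_iff)
  qed
  have z: "?K X = 0 \<longleftrightarrow> \<bar>X\<bar> = m" if "X \<in> {-m..m}" for X
    using that S zero separation_sq_pos[OF k_pos] separation_sq_half_width_iff(3) e by (simp add: m_def)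
  have "double_cover {-1..1} (\<lambda>x. 1 - x\<^sup>2) homeomorphic double_cover {-m..m} ?K"
  proof (rule homeomorphic_double_cover)
    show "continuous_on {-m..m} ?K" using S by (intro continuous_on_ysq_separation_sq) blast
    show "inj_on ((*) m) {-1..1}" using m by (simp add: inj_on_def)
    show im: "(*) m ` {-1..1} = {-m..m}" using m image_mult_atLeastAtMost[of m "-1" 1] by simp
    show "1 - x\<^sup>2 = 0 \<longleftrightarrow> ?K (m * x) = 0" if "x \<in> {-1..1}" for x
    proof -
      have "1 - x\<^sup>2 = 0 \<longleftrightarrow> \<bar>x\<bar> = 1" using abs_square_eq_1[of x] by auto
      moreover have "?K (m * x) = 0 \<longleftrightarrow> \<bar>m * x\<bar> = m" using that im by (intro z) blast
      ultimately show ?thesis using m by (simp add: abs_mult)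
    qed
  qed (use S in \<open>auto intro!: continuous_intros simp: abs_square_le_1 abs_le_iff\<close>)
  then have "circle homeomorphic double_cover {-m..m} ?K"
    using circle_homeomorphic_double_cover homeomorphic_trans by blast
  then have "circle \<times> double_cover {-m..m} ?K homeomorphic circle \<times> circle"
    by (intro homeomorphic_Times_cong homeomorphic_refl) (rule homeomorphic_sym[THEN iffD1])
  moreover have "integral_surface c (f, h) homeomorphic circle \<times> double_cover {-m..m} ?K"
    using integral_surface_homeomorphic[OF c S[unfolded k_def]] by (simp add: k_def)
  moreover have "circle \<times> circle homeomorphic {1..1::nat} \<times> (circle \<times> circle)"
  proof -
    have "homeomorphism (circle \<times> circle) ({1..1::nat} \<times> (circle \<times> circle)) (Pair 1) snd"
      by (rule homeomorphismI) (auto intro!: continuous_intros)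
    then show ?thesis by (auto simp: homeomorphic_def)
  qed
  ultimately show ?thesis by (meson homeomorphic_trans)
qed

text \<open>The range from \<open>e1\<close> to \<open>e2\<close> yields two mirror intervals of
  \<open>X\<close>, and \<open>e3 \<le> d\<close> yields a central one between them. Each has simple
  ends, so each carries one circle of the reduced curve.\<close>

lemma integral_surface_three_tori:
  assumes e: "0 < e1" "e1 < e2" "e2 < e3" "half_width c f k e3 > 0"
    and nonneg: "\<And>d. d > 0 \<Longrightarrow> ysq c f k d \<ge> 0 \<longleftrightarrow> e1 \<le> d \<and> d \<le> e2 \<or> e3 \<le> d"
    and zero: "\<And>d. d > 0 \<Longrightarrow> ysq c f k d = 0 \<longleftrightarrow> d = e1 \<or> d = e2 \<or> d = e3"
  shows "integral_surface c (f, h) homeomorphic {1..3::nat} \<times> (circle \<times> circle)"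
proof -
  define m1 m2 m3 where "m1 = half_width c f k e1" and "m2 = half_width c f k e2"
    and "m3 = half_width c f k e3"
  note m_defs = m1_def m2_def m3_def
  let ?K = "\<lambda>X. ysq c f k (separation_sq c f k X)"
  let ?S = "{-m1..-m2} \<union> {-m3..m3} \<union> {m2..m1}"
  have m: "0 < m3" "m3 < m2" "m2 < m1" "m1 < 2 - f"
    using e half_width_less half_width_strict_antimono by (auto simp: m_defs)
  have iffs: "e1 \<le> separation_sq c f k X \<longleftrightarrow> \<bar>X\<bar> \<le> m1" "separation_sq c f k X \<le> e2 \<longleftrightarrow> m2 \<le> \<bar>X\<bar>"
      "e3 \<le> separation_sq c f k X \<longleftrightarrow> \<bar>X\<bar> \<le> m3" "separation_sq c f k X = e1 \<longleftrightarrow> \<bar>X\<bar> = m1"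
      "separation_sq c f k X = e2 \<longleftrightarrow> \<bar>X\<bar> = m2" "separation_sq c f k X = e3 \<longleftrightarrow> \<bar>X\<bar> = m3"
    if "\<bar>X\<bar> < 2 - f" for X
    using separation_sq_half_width_iff[OF that] e m unfolding m_defs by auto
  have S: "X \<in> ?S \<longleftrightarrow> \<bar>X\<bar> < 2 - f \<and> ?K X \<ge> 0" for X
  proof -
    have "\<bar>X\<bar> < 2 - f \<Longrightarrow> ?K X \<ge> 0 \<longleftrightarrow> m2 \<le> \<bar>X\<bar> \<and> \<bar>X\<bar> \<le> m1 \<or> \<bar>X\<bar> \<le> m3"
      using nonneg separation_sq_pos[OF k_pos] iffs by auto
    moreover have "X \<in> ?S \<longleftrightarrow> \<bar>X\<bar> < 2 - f \<and> (m2 \<le> \<bar>X\<bar> \<and> \<bar>X\<bar> \<le> m1 \<or> \<bar>X\<bar> \<le> m3)"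
      using m by (auto simp: abs_if)
    ultimately show ?thesis by blast
  qed
  have z: "?K X = 0 \<longleftrightarrow> \<bar>X\<bar> = m1 \<or> \<bar>X\<bar> = m2 \<or> \<bar>X\<bar> = m3" if "X \<in> ?S" for X
  proof -
    have "\<bar>X\<bar> < 2 - f" using S that by blast
    then show ?thesis using zero separation_sq_pos[OF k_pos] iffs by simp
  qed
  \<comment> \<open>Centres and half lengths of the three intervals, numbered from left to
    right.\<close>
  define \<alpha> \<beta> :: "nat \<Rightarrow> real" where "\<alpha> n = (if n = 1 then - (m1 + m2) / 2 else if n = 2 then 0 else (m1 + m2) / 2)"
    and "\<beta> n = (if n = 2 then m3 else (m1 - m2) / 2)" for n
  define \<phi> where "\<phi> z = \<alpha> (fst z) + \<beta> (fst z) * snd z" for z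
  define I where "I n = (if n = 1 then {-m1..-m2} else if n = 2 then {-m3..m3} else {m2..m1})" for n :: nat
  have three: "{1..3::nat} = {1, 2, 3}" by auto
  have \<beta>: "\<beta> n > 0" for n using m by (simp add: \<beta>_def)
  have im: "(\<lambda>x. \<phi> (n, x)) ` {-1..1} = I n" for n
  proof -
    have "(\<lambda>x. \<phi> (n, x)) ` {-1..1} = (+) (\<alpha> n) ` (*) (\<beta> n) ` {-1..1}"
      by (simp add: \<phi>_def image_image)
    also have "\<dots> = {\<alpha> n - \<beta> n..\<alpha> n + \<beta> n}"
      using \<beta>[of n] image_mult_atLeastAtMost[of "\<beta> n" "-1" 1] image_add_atLeastAtMost[of "\<alpha> n" "- \<beta> n" "\<beta> n"]
      by simp
    also have "\<dots> = I n" by (auto simp: I_def \<alpha>_def \<beta>_def field_simps)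
    finally show ?thesis .
  qed
  have disj: "n = n'" if "x \<in> I n" "x \<in> I n'" "n \<in> {1..3}" "n' \<in> {1..3}" for x n n'
    using that m unfolding three I_def by auto
  have "double_cover ({1..3::nat} \<times> {-1..1}) (\<lambda>z. 1 - (snd z)\<^sup>2) homeomorphic double_cover ?S ?K"
  proof (rule homeomorphic_double_cover)
    show "compact ({1..3::nat} \<times> {-1..1::real})" by (intro compact_Times) (auto simp: finite_imp_compact)
    show "continuous_on ?S ?K" using S by (intro continuous_on_ysq_separation_sq) blast
    show "continuous_on ({1..3} \<times> {-1..1}) \<phi>"
    proof -
      have "continuous_on A (\<lambda>z. g (fst z))" for A :: "(nat \<times> real) set" and g :: "nat \<Rightarrow> real"
        by (rule continuous_on_compose2[OF _ continuous_on_fst[OF continuous_on_id], of UNIV g]) auto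
      then show ?thesis
        unfolding \<phi>_def by (intro continuous_on_add continuous_on_mult continuous_on_snd continuous_on_id)
    qed
    show "inj_on \<phi> ({1..3} \<times> {-1..1})"
    proof (rule inj_onI)
      fix z z' assume a: "z \<in> {1..3} \<times> {-1..1}" "z' \<in> {1..3} \<times> {-1..1}" "\<phi> z = \<phi> z'"
      have "\<phi> z \<in> I (fst z)" if "z \<in> {1..3} \<times> {-1..1}" for z
      proof -
        have "\<phi> (fst z, snd z) \<in> (\<lambda>x. \<phi> (fst z, x)) ` {-1..1}" using that by (intro imageI) auto
        then show ?thesis by (simp add: im)
      qed
      then have "\<phi> z \<in> I (fst z)" "\<phi> z' \<in> I (fst z')" using a by blast+
      then have "fst z = fst z'" using a disj[of "\<phi> z" "fst z" "fst z'"] by auto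
      moreover from this have "snd z = snd z'" using a(3) \<beta>[of "fst z'"] by (simp add: \<phi>_def)
      ultimately show "z = z'" by (simp add: prod_eq_iff)
    qed
    have "\<phi> ` ({1..3} \<times> {-1..1}) = (\<Union>n\<in>{1..3}. (\<lambda>x. \<phi> (n, x)) ` {-1..1})" by auto
    also have "\<dots> = ?S" unfolding im three by (simp add: I_def Un_ac)
    finally show im': "\<phi> ` ({1..3} \<times> {-1..1}) = ?S" .
    show "1 - (snd z)\<^sup>2 = 0 \<longleftrightarrow> ?K (\<phi> z) = 0" if "z \<in> {1..3} \<times> {-1..1}" for z
    proof -
      obtain n x where "z = (n, x)" by (cases z)
      with that have nx: "z = (n, x)" "x \<in> {-1..1}" "n \<in> {1, 2, 3}" unfolding three by auto
      have \<phi>z: "\<phi> z \<in> I n" using im[of n] nx by blast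
      have inj: "\<beta> n * x = \<beta> n * y \<longleftrightarrow> x = y" for y using \<beta>[of n] by simp
      have "1 - x\<^sup>2 = 0 \<longleftrightarrow> x = -1 \<or> x = 1" using abs_square_eq_1[of x] by auto
      also have "\<dots> \<longleftrightarrow> \<phi> z = \<alpha> n - \<beta> n \<or> \<phi> z = \<alpha> n + \<beta> n"
        using inj[of "-1"] inj[of 1] by (auto simp: \<phi>_def nx)
      also have "\<dots> \<longleftrightarrow> \<bar>\<phi> z\<bar> = m1 \<or> \<bar>\<phi> z\<bar> = m2 \<or> \<bar>\<phi> z\<bar> = m3"
      proof -
        have ends: "\<alpha> 1 - \<beta> 1 = - m1" "\<alpha> 1 + \<beta> 1 = - m2" "\<alpha> 2 - \<beta> 2 = - m3" "\<alpha> 2 + \<beta> 2 = m3"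
          "\<alpha> 3 - \<beta> 3 = m2" "\<alpha> 3 + \<beta> 3 = m1"
          by (simp_all add: \<alpha>_def \<beta>_def field_simps)
        from nx(3) consider "n = 1" | "n = 2" | "n = 3" by blast
        then show ?thesis
        proof cases
          case 1
          with \<phi>z have "\<phi> z \<in> {-m1..-m2}" by (simp add: I_def)
          then show ?thesis unfolding 1 ends using m by (auto simp: abs_eq_iff')
        next
          case 2
          with \<phi>z have "\<phi> z \<in> {-m3..m3}" by (simp add: I_def)
          then show ?thesis unfolding 2 ends using m by (auto simp: abs_eq_iff')
        next
          case 3
          with \<phi>z have "\<phi> z \<in> {m2..m1}" by (simp add: I_def)
          then show ?thesis unfolding 3 ends using m by (auto simp: abs_eq_iff')
        qed
      qed
      also have "\<dots> \<longleftrightarrow> ?K (\<phi> z) = 0" using z[of "\<phi> z"] im' that by blast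
      finally show ?thesis by (simp add: nx)
    qed
  qed (use S in \<open>auto intro!: continuous_intros simp: abs_square_le_1 abs_le_iff\<close>)
  then have cover: "{1..3::nat} \<times> double_cover {-1..1} (\<lambda>x. 1 - x\<^sup>2) homeomorphic double_cover ?S ?K"
    by (rule homeomorphic_trans[OF Times_double_cover_homeomorphic])
  have "{1..3::nat} \<times> circle homeomorphic {1..3::nat} \<times> double_cover {-1..1} (\<lambda>x. 1 - x\<^sup>2)"
    by (intro homeomorphic_Times_cong homeomorphic_refl circle_homeomorphic_double_cover)
  then have "{1..3::nat} \<times> circle homeomorphic double_cover ?S ?K"
    using cover by (rule homeomorphic_trans)
  then have "circle \<times> double_cover ?S ?K homeomorphic circle \<times> ({1..3::nat} \<times> circle)"
    by (intro homeomorphic_Times_cong homeomorphic_refl) (rule homeomorphic_sym[THEN iffD1])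
  moreover have "integral_surface c (f, h) homeomorphic circle \<times> double_cover ?S ?K"
    using integral_surface_homeomorphic[OF c S[unfolded k_def]] by (simp add: k_def)
  moreover have "circle \<times> ({1..3::nat} \<times> circle) homeomorphic {1..3::nat} \<times> (circle \<times> circle)"
    by (rule Times_swap_homeomorphic)
  ultimately show ?thesis by (meson homeomorphic_trans)
qed

text \<open>The radicand is nonnegative on a single interval of \<open>X\<close> and vanishes at its
  ends and at two interior points. The model \<open>chain_height\<close> has the same pattern, with
  zeros at -1, 1, 3, 5.\<close>

lemma integral_surface_chain:
  assumes e: "0 < e1" "e1 < e0" "half_width c f k e0 > 0"
    and nonneg: "\<And>d. d > 0 \<Longrightarrow> ysq c f k d \<ge> 0 \<longleftrightarrow> e1 \<le> d"
    and zero: "\<And>d. d > 0 \<Longrightarrow> ysq c f k d = 0 \<longleftrightarrow> d = e1 \<or> d = e0"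
  shows "integral_surface c (f, h) homeomorphic circle \<times> three_circle_chain"
proof -
  define m1 m0 where "m1 = half_width c f k e1" and "m0 = half_width c f k e0"
  note m_defs = m1_def m0_def
  let ?K = "\<lambda>X. ysq c f k (separation_sq c f k X)"
  have m: "0 < m0" "m0 < m1" "m1 < 2 - f"
    using e half_width_less half_width_strict_antimono by (auto simp: m_defs)
  have iffs: "e1 \<le> separation_sq c f k X \<longleftrightarrow> \<bar>X\<bar> \<le> m1" 
      "separation_sq c f k X = e1 \<longleftrightarrow> \<bar>X\<bar> = m1" "separation_sq c f k X = e0 \<longleftrightarrow> \<bar>X\<bar> = m0"
    if "\<bar>X\<bar> < 2 - f" for X
    using separation_sq_half_width_iff[OF that] e m unfolding m_defs by auto
  have S: "X \<in> {-m1..m1} \<longleftrightarrow> \<bar>X\<bar> < 2 - f \<and> ?K X \<ge> 0" for X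
  proof -
    have "\<bar>X\<bar> < 2 - f \<Longrightarrow> ?K X \<ge> 0 \<longleftrightarrow> \<bar>X\<bar> \<le> m1"
      using nonneg separation_sq_pos[OF k_pos] iffs by auto
    then show ?thesis using m by (auto simp: abs_le_iff)
  qed
  have z: "?K X = 0 \<longleftrightarrow> \<bar>X\<bar> = m1 \<or> \<bar>X\<bar> = m0" if "X \<in> {-m1..m1}" for X
  proof -
    have "\<bar>X\<bar> < 2 - f" using S that by blast
    then show ?thesis using zero separation_sq_pos[OF k_pos] iffs by simp
  qed
  \<comment> \<open>Piecewise linear map taking -1, 1, 3, 5 to -m1, -m0, m0, m1. The clamped terms
    give one continuous formula: the first varies only on [1, 3], the second only outside
    it.\<close>
  define \<phi> where "\<phi> x = m0 * max (-1) (min 1 (x - 2)) + (m1 - m0) / 2 * (min 0 (x - 1) + max 0 (x - 3))" for x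
  have \<phi>l: "\<phi> x = - m0 + (m1 - m0) / 2 * (x - 1)" if "x \<in> {-1..1}" for x
    using that by (simp add: \<phi>_def)
  have \<phi>m: "\<phi> x = m0 * (x - 2)" if "x \<in> {1..3}" for x
    using that by (simp add: \<phi>_def)
  have \<phi>r: "\<phi> x = m0 + (m1 - m0) / 2 * (x - 3)" if "x \<in> {3..5}" for x
    using that by (simp add: \<phi>_def)
  have cont: "continuous_on S \<phi>" for S unfolding \<phi>_def by (intro continuous_intros)
  have mono: "\<phi> x < \<phi> y" if "x < y" for x y
  proof -
    \<comment> \<open>Both terms are nondecreasing, and at least one increases strictly between any
      two points.\<close>
    define t u where "t x = max (-1) (min 1 (x - 2))" and "u x = min 0 (x - 1) + max 0 (x - 3)" for x :: real
    have strict: "t x < t y \<or> u x < u y" and le: "t x \<le> t y" "u x \<le> u y"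
      using that by (auto simp: t_def u_def max_def min_def)
    have "m0 * t x \<le> m0 * t y" "(m1 - m0) / 2 * u x \<le> (m1 - m0) / 2 * u y"
      using le m by (auto intro!: mult_left_mono)
    moreover have "m0 * t x < m0 * t y \<or> (m1 - m0) / 2 * u x < (m1 - m0) / 2 * u y"
      using strict m by (simp add: mult_less_cancel_left_pos)
    ultimately show ?thesis unfolding \<phi>_def t_def u_def by linarith
  qed
  then have sm: "strict_mono \<phi>" by (simp add: strict_mono_def)
  have ends: "\<phi> (-1) = - m1" "\<phi> 5 = m1" by (simp_all add: \<phi>_def field_simps)
  have "double_cover {-1..5} chain_height homeomorphic double_cover {-m1..m1} ?K"
  proof (rule homeomorphic_double_cover)
    show "continuous_on {-1..5} chain_height"
      unfolding chain_height_def by (intro continuous_intros)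
    show "continuous_on {-m1..m1} ?K" using S by (intro continuous_on_ysq_separation_sq) blast
    show "inj_on \<phi> {-1..5}" using sm by (rule strict_mono_imp_inj_on)
    show im: "\<phi> ` {-1..5} = {-m1..m1}"
    proof
      show "\<phi> ` {-1..5} \<subseteq> {-m1..m1}"
        using strict_mono_less_eq[OF sm, of "-1"] strict_mono_less_eq[OF sm, of _ 5] ends by auto
      show "{-m1..m1} \<subseteq> \<phi> ` {-1..5}"
      proof
        fix y assume "y \<in> {-m1..m1}"
        then obtain x where "-1 \<le> x" "x \<le> 5" "\<phi> x = y"
          using IVT'[of \<phi> "-1" y 5] cont ends by auto
        then show "y \<in> \<phi> ` {-1..5}" by auto
      qed
    qed
    fix x :: real assume x: "x \<in> {-1..5}"
    then consider "x \<in> {-1..1}" | "x \<in> {1..3}" | "x \<in> {3..5}" by fastforce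
    note cases = this
    have sq: "1 - t\<^sup>2 \<ge> 0" "1 - t\<^sup>2 = 0 \<longleftrightarrow> t = -1 \<or> t = 1" if "\<bar>t\<bar> \<le> 1" for t :: real
      using that abs_square_eq_1[of t] abs_square_le_1[of t] by auto
    show "chain_height x \<ge> 0"
      by (cases rule: cases) (use chain_height_eq[of x] sq in \<open>auto simp: abs_le_iff\<close>)
    have "chain_height x = 0 \<longleftrightarrow> x = -1 \<or> x = 1 \<or> x = 3 \<or> x = 5"
    proof (cases rule: cases)
      case 1
      then show ?thesis using chain_height_eq(1) sq(2)[of x] by auto
    next
      case 2
      then show ?thesis using chain_height_eq(2) sq(2)[of "x - 2"] by auto
    next
      case 3
      then show ?thesis using chain_height_eq(3) sq(2)[of "x - 4"] by auto
    qed
    also have "\<dots> \<longleftrightarrow> \<phi> x = - m1 \<or> \<phi> x = - m0 \<or> \<phi> x = m0 \<or> \<phi> x = m1"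
    proof -
      have "\<phi> 1 = - m0" "\<phi> 3 = m0" by (simp_all add: \<phi>_def)
      then show ?thesis using strict_mono_eq[OF sm, of x] ends by metis
    qed
    also have "\<dots> \<longleftrightarrow> ?K (\<phi> x) = 0"
    proof -
      have "\<phi> x \<in> {-m1..m1}" using im x by blast
      then show ?thesis unfolding z[OF \<open>\<phi> x \<in> _\<close>] using m by (auto simp: abs_eq_iff')
    qed
    finally show "chain_height x = 0 \<longleftrightarrow> ?K (\<phi> x) = 0" .
  qed (use S cont in auto)
  then have "three_circle_chain homeomorphic double_cover {-m1..m1} ?K"
    using three_circle_chain_homeomorphic_double_cover homeomorphic_trans by blast
  then have "circle \<times> double_cover {-m1..m1} ?K homeomorphic circle \<times> three_circle_chain"
    by (intro homeomorphic_Times_cong homeomorphic_refl) (rule homeomorphic_sym[THEN iffD1])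
  moreover have "integral_surface c (f, h) homeomorphic circle \<times> double_cover {-m1..m1} ?K"
    using integral_surface_homeomorphic[OF c S[unfolded k_def]] by (simp add: k_def)
  ultimately show ?thesis by (meson homeomorphic_trans)
qed

end

section \<open>Critical points of the momentum map\<close>

definition momentum_derivative ::
    "real \<Rightarrow> real \<times> real \<times> real \<times> real \<Rightarrow> real \<times> real \<times> real \<times> real \<Rightarrow> real \<times> real" where
  "momentum_derivative c = (\<lambda>(x1, y1, x2, y2) (u1, v1, u2, v2).
     (2 * (x1 * u1 + y1 * v1 + x2 * u2 + y2 * v2),
      - (x1 * u1 + y1 * v1) / (1 - (x1\<^sup>2 + y1\<^sup>2)) - (x2 * u2 + y2 * v2) / (1 - (x2\<^sup>2 + y2\<^sup>2))
      - c / ((x2 - x1)\<^sup>2 + (y2 - y1)\<^sup>2) * ((x2 - x1) * (u2 - u1) + (y2 - y1) * (v2 - v1))))"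

lemma has_derivative_ln_sum_squares:
  fixes a b :: "'a::real_normed_vector \<Rightarrow> real"
  assumes "(a has_derivative a') (at x)" "(b has_derivative b') (at x)" "(a x)\<^sup>2 + (b x)\<^sup>2 > 0"
  shows "((\<lambda>x. ln ((a x)\<^sup>2 + (b x)\<^sup>2)) has_derivative
    (\<lambda>v. 2 * (a x * a' v + b x * b' v) / ((a x)\<^sup>2 + (b x)\<^sup>2))) (at x)"
  by (rule derivative_eq_intros assms refl)+ (auto simp: fun_eq_iff field_simps)

lemma has_derivative_ln_one_minus_sum_squares:
  fixes a b :: "'a::real_normed_vector \<Rightarrow> real"
  assumes "(a has_derivative a') (at x)" "(b has_derivative b') (at x)" "1 - ((a x)\<^sup>2 + (b x)\<^sup>2) > 0"
  shows "((\<lambda>x. ln (1 - ((a x)\<^sup>2 + (b x)\<^sup>2))) has_derivative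
    (\<lambda>v. - 2 * (a x * a' v + b x * b' v) / (1 - ((a x)\<^sup>2 + (b x)\<^sup>2)))) (at x)"
  by (rule derivative_eq_intros assms refl)+ (auto simp: fun_eq_iff field_simps)

lemma momentum_map_has_derivative:
  assumes "\<zeta> \<in> phase_space"
  shows "(momentum_map c has_derivative momentum_derivative c \<zeta>) (at \<zeta>)"
proof -
  obtain x1 y1 x2 y2 where \<zeta>: "\<zeta> = (x1, y1, x2, y2)" by (cases \<zeta>)
  let ?x1 = "\<lambda>z::real\<times>real\<times>real\<times>real. fst z" and ?y1 = "\<lambda>z::real\<times>real\<times>real\<times>real. fst (snd z)"
    and ?x2 = "\<lambda>z::real\<times>real\<times>real\<times>real. fst (snd (snd z))" and ?y2 = "\<lambda>z::real\<times>real\<times>real\<times>real. snd (snd (snd z))"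
  have pos: "1 - (x1\<^sup>2 + y1\<^sup>2) > 0" "1 - (x2\<^sup>2 + y2\<^sup>2) > 0"
    and sep: "\<not> (x1 = x2 \<and> y1 = y2)"
    using assms by (auto simp: \<zeta> phase_space_def)
  have d: "(x2 - x1)\<^sup>2 + (y2 - y1)\<^sup>2 > 0"
    using sep by (auto simp: sum_power2_gt_zero_iff)
  note proj = bounded_linear_imp_has_derivative[OF bounded_linear_fst]
    bounded_linear_imp_has_derivative[OF bounded_linear_compose[OF bounded_linear_fst bounded_linear_snd]]
    bounded_linear_imp_has_derivative[OF bounded_linear_compose[OF bounded_linear_fst
        bounded_linear_compose[OF bounded_linear_snd bounded_linear_snd]]]
    bounded_linear_imp_has_derivative[OF bounded_linear_compose[OF bounded_linear_snd
        bounded_linear_compose[OF bounded_linear_snd bounded_linear_snd]]]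
  have L1: "((\<lambda>z. ln (1 - ((?x1 z)\<^sup>2 + (?y1 z)\<^sup>2))) has_derivative
      (\<lambda>v. - 2 * (x1 * ?x1 v + y1 * ?y1 v) / (1 - (x1\<^sup>2 + y1\<^sup>2)))) (at \<zeta>)"
    using has_derivative_ln_one_minus_sum_squares[OF proj(1) proj(2), of \<zeta>] pos by (simp add: \<zeta>)
  have L2: "((\<lambda>z. ln (1 - ((?x2 z)\<^sup>2 + (?y2 z)\<^sup>2))) has_derivative
      (\<lambda>v. - 2 * (x2 * ?x2 v + y2 * ?y2 v) / (1 - (x2\<^sup>2 + y2\<^sup>2)))) (at \<zeta>)"
    using has_derivative_ln_one_minus_sum_squares[OF proj(3) proj(4), of \<zeta>] pos by (simp add: \<zeta>)
  have L3: "((\<lambda>z. ln ((?x2 z - ?x1 z)\<^sup>2 + (?y2 z - ?y1 z)\<^sup>2)) has_derivative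
      (\<lambda>v. 2 * ((x2 - x1) * (?x2 v - ?x1 v) + (y2 - y1) * (?y2 v - ?y1 v))
         / ((x2 - x1)\<^sup>2 + (y2 - y1)\<^sup>2))) (at \<zeta>)"
    using has_derivative_ln_sum_squares[OF has_derivative_diff[OF proj(3) proj(1)]
        has_derivative_diff[OF proj(4) proj(2)], of \<zeta>] d by (simp add: \<zeta>)
  have F: "(vorticity_moment has_derivative
      (\<lambda>v. 2 * (x1 * ?x1 v + y1 * ?y1 v + x2 * ?x2 v + y2 * ?y2 v))) (at \<zeta>)"
    unfolding vorticity_moment_def case_prod_unfold
    by (rule derivative_eq_intros proj refl)+ (simp add: \<zeta> fun_eq_iff algebra_simps)
  have H: "(hamiltonian c has_derivative
      (\<lambda>v. 1/2 * (- 2 * (x1 * ?x1 v + y1 * ?y1 v) / (1 - (x1\<^sup>2 + y1\<^sup>2)))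
         + 1/2 * (- 2 * (x2 * ?x2 v + y2 * ?y2 v) / (1 - (x2\<^sup>2 + y2\<^sup>2)))
         - c/2 * (2 * ((x2 - x1) * (?x2 v - ?x1 v) + (y2 - y1) * (?y2 v - ?y1 v))
         / ((x2 - x1)\<^sup>2 + (y2 - y1)\<^sup>2)))) (at \<zeta>)"
    unfolding hamiltonian_def case_prod_unfold
    by (intro has_derivative_diff has_derivative_add has_derivative_mult_right L1 L2 L3)
  have halves: "1/2 * (- 2 * s / m) + 1/2 * (- 2 * s' / m') - c/2 * (2 * t / n) = - s / m - s' / m' - c / n * t"
    for s m s' m' t n :: real by simp
  have "momentum_map c = (\<lambda>z. (vorticity_moment z, hamiltonian c z))"
    by (simp add: fun_eq_iff momentum_map_def)
  moreover have "momentum_derivative c \<zeta> = (\<lambda>v. (2 * (x1 * ?x1 v + y1 * ?y1 v + x2 * ?x2 v + y2 * ?y2 v),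
      - (x1 * ?x1 v + y1 * ?y1 v) / (1 - (x1\<^sup>2 + y1\<^sup>2)) - (x2 * ?x2 v + y2 * ?y2 v) / (1 - (x2\<^sup>2 + y2\<^sup>2))
      - c / ((x2 - x1)\<^sup>2 + (y2 - y1)\<^sup>2) * ((x2 - x1) * (?x2 v - ?x1 v) + (y2 - y1) * (?y2 v - ?y1 v))))"
    unfolding momentum_derivative_def \<zeta> case_prod_unfold fst_conv snd_conv ..
  ultimately show ?thesis
    using has_derivative_Pair[OF F H[unfolded halves]] by (simp only:)
qed

section \<open>From rank deficiency to multiple zeros, and back\<close>

lemma critical_points_iff:
  "\<zeta> \<in> critical_points c \<longleftrightarrow> \<zeta> \<in> phase_space \<and> dim (range (momentum_derivative c \<zeta>)) < 2"
  using frechet_derivative_at[OF momentum_map_has_derivative[of \<zeta> c]]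
  by (cases "\<zeta> \<in> phase_space") (simp_all add: critical_points_def)

text \<open>A range of dimension below two admits a nonzero orthogonal vector (a, b), which means a
  dF + b dH = 0.\<close>

lemma critical_point_relation:
  assumes "\<zeta> \<in> critical_points c"
  shows "\<exists>a b. (a, b) \<noteq> (0, 0) \<and>
    (\<forall>v. a * fst (momentum_derivative c \<zeta> v) + b * snd (momentum_derivative c \<zeta> v) = 0)"
proof -
  have "dim (range (momentum_derivative c \<zeta>)) < DIM(real \<times> real)"
    using assms by (simp add: critical_points_iff)
  then obtain x where "x \<noteq> 0" "\<And>y. y \<in> span (range (momentum_derivative c \<zeta>)) \<Longrightarrow> orthogonal x y"
    using orthogonal_to_subspace_exists by blast
  then show ?thesis
    by (intro exI[of _ "fst x"] exI[of _ "snd x"])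
      (auto simp: orthogonal_def inner_prod_def prod_eq_iff span_base)
qed

text \<open>The relation between the differentials gives A1 z_1 = -\<kappa> z_2 and A2 z_2 =
  -\<kappa> z_1, hence Y = 0. Eliminating the multiplier leaves X (p + \<kappa> m1 m2) = 0. The
  first factor gives \<open>d = 2 * f\<close>, and the second is a quarter of \<open>dysq\<close>,
  so the zero is then multiple.\<close>

lemma critical_point_multiplier:
  fixes c f h :: real
  defines "k \<equiv> 4 * exp (2 * h)"
  assumes c: "c > 0" and crit: "\<zeta> \<in> critical_points c" and surf: "\<zeta> \<in> integral_surface c (f, h)"
  shows "\<exists>d>0. ysq c f k d = 0 \<and> (d = 2 * f \<or> dysq c f k d = 0)"
proof -
  obtain x1 y1 x2 y2 where \<zeta>: "\<zeta> = (x1, y1, x2, y2)" by (cases \<zeta>)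
  define d X Y m1 m2 \<kappa> p where "d = (x2 - x1)\<^sup>2 + (y2 - y1)\<^sup>2" and "X = x1\<^sup>2 + y1\<^sup>2 - (x2\<^sup>2 + y2\<^sup>2)"
    and "Y = 2 * (x1 * y2 - y1 * x2)" and "m1 = 1 - (x1\<^sup>2 + y1\<^sup>2)" and "m2 = 1 - (x2\<^sup>2 + y2\<^sup>2)"
    and "\<kappa> = c / d" and "p = x1 * x2 + y1 * y2"
  have f: "x1\<^sup>2 + y1\<^sup>2 + x2\<^sup>2 + y2\<^sup>2 = f" and d: "d > 0" and Xd: "(2 - f)\<^sup>2 - X\<^sup>2 = k * d powr c"
    using surf unfolding \<zeta> integral_surface_iff by (auto simp: d_def X_def k_def)
  have m: "m1 > 0" "m2 > 0" using surf by (auto simp: \<zeta> integral_surface_def phase_space_def m1_def m2_def)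
  have \<kappa>: "\<kappa> > 0" using c d by (simp add: \<kappa>_def)
  have XY: "X\<^sup>2 + Y\<^sup>2 = 2 * f * d - d\<^sup>2"
    unfolding d_def X_def Y_def f[symmetric] by (simp add: power2_eq_square algebra_simps)
  obtain a b where ab: "(a, b) \<noteq> (0, 0)" and
    rel: "\<And>v. a * fst (momentum_derivative c \<zeta> v) + b * snd (momentum_derivative c \<zeta> v) = 0"
    using critical_point_relation[OF crit] by blast
  have eqs: "a * (2 * x1) + b * (- x1 / m1 + \<kappa> * (x2 - x1)) = 0"
    "a * (2 * y1) + b * (- y1 / m1 + \<kappa> * (y2 - y1)) = 0"
    "a * (2 * x2) + b * (- x2 / m2 - \<kappa> * (x2 - x1)) = 0"
    "a * (2 * y2) + b * (- y2 / m2 - \<kappa> * (y2 - y1)) = 0"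
  proof -
    have "momentum_derivative c \<zeta> (1, 0, 0, 0) = (2 * x1, - x1 / m1 + \<kappa> * (x2 - x1))"
      "momentum_derivative c \<zeta> (0, 1, 0, 0) = (2 * y1, - y1 / m1 + \<kappa> * (y2 - y1))"
      "momentum_derivative c \<zeta> (0, 0, 1, 0) = (2 * x2, - x2 / m2 - \<kappa> * (x2 - x1))"
      "momentum_derivative c \<zeta> (0, 0, 0, 1) = (2 * y2, - y2 / m2 - \<kappa> * (y2 - y1))"
      by (simp_all add: momentum_derivative_def \<zeta> flip: m1_def m2_def d_def \<kappa>_def)
        (simp_all add: \<kappa>_def diff_divide_distrib algebra_simps)
    then show "a * (2 * x1) + b * (- x1 / m1 + \<kappa> * (x2 - x1)) = 0"
      "a * (2 * y1) + b * (- y1 / m1 + \<kappa> * (y2 - y1)) = 0"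
      "a * (2 * x2) + b * (- x2 / m2 - \<kappa> * (x2 - x1)) = 0"
      "a * (2 * y2) + b * (- y2 / m2 - \<kappa> * (y2 - y1)) = 0"
      using rel[of "(1, 0, 0, 0)"] rel[of "(0, 1, 0, 0)"] rel[of "(0, 0, 1, 0)"] rel[of "(0, 0, 0, 1)"]
      by (simp_all only: fst_conv snd_conv)
  qed
  \<comment> \<open>A relation involving dF alone would put both vortices at the origin, which is a
    collision.\<close>
  have b: "b \<noteq> 0"
  proof
    assume "b = 0"
    then have "a \<noteq> 0" "a * x1 = 0" "a * y1 = 0" "a * x2 = 0" "a * y2 = 0" using ab eqs by auto
    then show False using d by (simp add: d_def)
  qed
  define A1 A2 where "A1 = 2 * a / b - 1 / m1 - \<kappa>" and "A2 = 2 * a / b - 1 / m2 - \<kappa>"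
  have A: "A1 * x1 = - \<kappa> * x2" "A1 * y1 = - \<kappa> * y2" "A2 * x2 = - \<kappa> * x1" "A2 * y2 = - \<kappa> * y1"
  proof -
    have *: "(2 * a / b - 1 / m - \<kappa>) * s = - \<kappa> * t"
      if "a * (2 * s) + b * (- s / m + \<kappa> * (t - s)) = 0" for m s t
    proof -
      have "b * ((2 * a / b - 1 / m - \<kappa>) * s + \<kappa> * t) = a * (2 * s) + b * (- s / m + \<kappa> * (t - s))"
        using b by (simp add: field_simps)
      then show ?thesis using b that by simp
    qed
    show "A1 * x1 = - \<kappa> * x2" "A1 * y1 = - \<kappa> * y2" "A2 * x2 = - \<kappa> * x1" "A2 * y2 = - \<kappa> * y1"
      unfolding A1_def A2_def by (rule *; use eqs in \<open>simp add: algebra_simps\<close>)+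
  qed
  have "\<kappa> * Y = 2 * (y1 * (- \<kappa> * x2) - x1 * (- \<kappa> * y2))" by (simp add: Y_def algebra_simps)
  also have "\<dots> = 0" unfolding A(1,2)[symmetric] by (simp add: algebra_simps)
  finally have Y: "Y = 0" using \<kappa> by simp
  have y0: "ysq c f k d = 0" using XY Xd Y by (simp add: ysq_def)
  have "A1 * p = - \<kappa> * (x2\<^sup>2 + y2\<^sup>2)" 
  proof -
    have "A1 * p = (A1 * x1) * x2 + (A1 * y1) * y2" by (simp add: p_def algebra_simps)
    then show ?thesis unfolding A by (simp add: power2_eq_square algebra_simps)
  qed
  moreover have "A2 * p = - \<kappa> * (x1\<^sup>2 + y1\<^sup>2)"
  proof -
    have "A2 * p = (A2 * x2) * x1 + (A2 * y2) * y1" by (simp add: p_def algebra_simps)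
    then show ?thesis unfolding A by (simp add: power2_eq_square algebra_simps)
  qed
  ultimately have Ap: "(A1 - A2) * p = \<kappa> * X" by (simp add: X_def algebra_simps)
  have Am: "(A1 - A2) * (m1 * m2) = - X"
  proof -
    have "(A1 - A2) * (m1 * m2) = (1 / m2 - 1 / m1) * (m1 * m2)" by (simp add: A1_def A2_def)
    also have "\<dots> = m1 - m2" using m by (simp add: field_simps)
    finally show ?thesis by (simp add: X_def m1_def m2_def)
  qed
  \<comment> \<open>The difference A1 - A2 is eliminated between \<open>Ap\<close> and
    \<open>Am\<close>.\<close>
  have "X * (p + \<kappa> * (m1 * m2)) = (\<kappa> * X) * (m1 * m2) - (- X) * p"
    by (simp add: algebra_simps)
  also have "\<dots> = 0" unfolding Ap[symmetric] Am[symmetric] by (simp add: algebra_simps)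
  finally have "X * (p + \<kappa> * (m1 * m2)) = 0" .
  then consider "X = 0" | "p + \<kappa> * (m1 * m2) = 0" by auto
  then have "d = 2 * f \<or> dysq c f k d = 0"
  proof cases
    case 1
    have "d * (2 * f - d) = X\<^sup>2 + Y\<^sup>2" unfolding XY by (simp add: power2_eq_square algebra_simps)
    then have "d * (2 * f - d) = 0" using 1 Y by simp
    then show ?thesis using d by simp
  next
    case 2
    have p: "p = (f - d) / 2" unfolding p_def d_def f[symmetric] by (simp add: power2_eq_square algebra_simps)
    have "4 * (m1 * m2) = (2 - f)\<^sup>2 - X\<^sup>2"
      unfolding m1_def m2_def X_def f[symmetric] by (simp add: power2_eq_square algebra_simps)
    then have mm: "m1 * m2 = k * d powr c / 4" using Xd by simp
    have dc: "d powr c = d powr (c - 1) * d" using d by (simp add: powr_diff)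
    have "dysq c f k d = 4 * (p + \<kappa> * (m1 * m2))"
      using d unfolding p mm \<kappa>_def dc dysq_def by (simp add: field_simps)
    then show ?thesis using 2 by simp
  qed
  then show ?thesis using d y0 by blast
qed

lemma regular_value:
  fixes c f h :: real
  defines "k \<equiv> 4 * exp (2 * h)"
  assumes "c > 0" "\<And>d. d > 0 \<Longrightarrow> ysq c f k d = 0 \<Longrightarrow> d \<noteq> 2 * f \<and> dysq c f k d \<noteq> 0"
  shows "(f, h) \<notin> bifurcation_diagram c"
proof
  assume "(f, h) \<in> bifurcation_diagram c"
  then obtain \<zeta> where "\<zeta> \<in> critical_points c" "\<zeta> \<in> integral_surface c (f, h)"
    by (auto simp: bifurcation_diagram_def integral_surface_def critical_points_def)
  then show False using critical_point_multiplier[of c \<zeta> f h] assms by blast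
qed

text \<open>The converse for a multiple zero with X > 0: the configuration with Y = 0 is placed on
  the real axis, and dH is shown to be a multiple of dF there.\<close>

lemma critical_value:
  fixes c f h :: real
  defines "k \<equiv> 4 * exp (2 * h)"
  assumes c: "c > 0" and f: "f < 2" and d: "d > 0" and y: "ysq c f k d = 0" "dysq c f k d = 0"
    and pos: "(2 - f)\<^sup>2 - k * d powr c > 0"
  shows "(f, h) \<in> bifurcation_diagram c"
proof -
  define X r where "X = sqrt ((2 - f)\<^sup>2 - k * d powr c)" and "r = sqrt d"
  \<comment> \<open>The point over (X, 0) with phase 1 under the inverse map of the reduction;
    \<open>r1 - r2 = r\<close>.\<close>
  define r1 r2 where "r1 = (X + d) / (2 * r)" and "r2 = (X - d) / (2 * r)"
  have r: "r > 0" "r\<^sup>2 = d" using d by (auto simp: r_def)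
  have X: "X > 0" and X2: "X\<^sup>2 = (2 - f)\<^sup>2 - k * d powr c" using pos by (auto simp: X_def)
  have XY: "X\<^sup>2 = 2 * f * d - d\<^sup>2" using X2 y by (simp add: ysq_def)
  have k: "k > 0" by (simp add: k_def)
  have Xf: "\<bar>X\<bar> < 2 - f"
  proof -
    have "X\<^sup>2 < (2 - f)\<^sup>2" using X2 k d by simp
    then show ?thesis using f X by (simp add: power_less_imp_less_base)
  qed
  have n: "r1\<^sup>2 = (X + d)\<^sup>2 / (4 * d)" "r2\<^sup>2 = (X - d)\<^sup>2 / (4 * d)"
    using r by (simp_all add: r1_def r2_def power_divide power_mult_distrib)
  have sum: "r1\<^sup>2 + r2\<^sup>2 = f"
  proof -
    have "(X + d)\<^sup>2 + (X - d)\<^sup>2 = f * (4 * d)" using XY by (simp add: power2_eq_square algebra_simps)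
    then show ?thesis unfolding n add_divide_distrib[symmetric] using d by simp
  qed
  have diff: "r1\<^sup>2 - r2\<^sup>2 = X"
  proof -
    have "(X + d)\<^sup>2 - (X - d)\<^sup>2 = X * (4 * d)" by (simp add: power2_eq_square algebra_simps)
    then show ?thesis unfolding n diff_divide_distrib[symmetric] using d by simp
  qed
  have "r2 - r1 = - (d / r)" using r by (simp add: r1_def r2_def field_simps)
  also have "\<dots> = - r" using r by (simp add: field_simps power2_eq_square)
  finally have r21: "r2 - r1 = - r" .
  have r1: "r1 > 0" using X d r by (simp add: r1_def)
  let ?\<zeta> = "(r1, 0, r2, 0) :: real \<times> real \<times> real \<times> real"
  have surf: "?\<zeta> \<in> integral_surface c (f, h)"
    unfolding integral_surface_iff using sum diff r21 r d Xf X2 by (simp add: k_def)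
  \<comment> \<open>The multiplier \<open>\<mu>\<close> is solved from the equation of the first
    vortex (\<open>first\<close>). That it also fits the second vortex (\<open>second\<close>) is
    where the vanishing of \<open>dysq\<close> enters, through \<open>key\<close>.\<close>
  define m1 m2 \<mu> where "m1 = 1 - r1\<^sup>2" and "m2 = 1 - r2\<^sup>2" and "\<mu> = (- 1 / m1 - c / d * r / r1) / 2"
  have m: "m1 > 0" "m2 > 0"
    using surf by (auto simp: integral_surface_def phase_space_def m1_def m2_def)
  have "4 * (m1 * m2) = (2 - f)\<^sup>2 - X\<^sup>2"
    unfolding m1_def m2_def diff[symmetric] sum[symmetric] by (simp add: power2_eq_square algebra_simps)
  then have mm: "m1 * m2 = k * d powr c / 4" using X2 by simp
  have rr: "r1 * r2 = (f - d) / 2"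
  proof -
    have "(r2 - r1)\<^sup>2 = d" using r21 r by simp
    then show ?thesis using sum by (simp add: power2_eq_square algebra_simps)
  qed
  have dc: "d powr c = d powr (c - 1) * d" using d by (simp add: powr_diff)
  have "4 * (r1 * r2 + c / d * (m1 * m2)) = dysq c f k d"
    using d unfolding rr mm dc dysq_def by (simp add: field_simps)
  then have key: "r1 * r2 = - (c / d) * (m1 * m2)" using y by simp
  have second: "- r2 / m2 + c / d * r = 2 * r2 * \<mu>"
  proof -
    have "(- r2 / m2 + c / d * r - 2 * r2 * \<mu>) * r1 = r1 * r2 * (1 / m1 - 1 / m2) + c / d * (r * (r1 + r2))"
      using r1 d by (simp add: \<mu>_def field_simps)
    also have "r * (r1 + r2) = X"
    proof -
      have "r * (r1 + r2) = (r1 - r2) * (r1 + r2)" using r21 by simp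
      also have "\<dots> = r1\<^sup>2 - r2\<^sup>2" by (simp add: power2_eq_square algebra_simps)
      finally show ?thesis using diff by simp
    qed
    also have "r1 * r2 * (1 / m1 - 1 / m2) = - (c / d) * (m1 * m2 * (1 / m1 - 1 / m2))"
      unfolding key by simp
    also have "m1 * m2 * (1 / m1 - 1 / m2) = m2 - m1" using m by (simp add: field_simps)
    also have "m2 - m1 = X" using diff by (simp add: m1_def m2_def)
    finally show ?thesis using r1 by simp
  qed
  have first: "- r1 / m1 - c / d * r = 2 * r1 * \<mu>"
    using r1 by (simp add: \<mu>_def field_simps)
  have "momentum_derivative c ?\<zeta> v \<in> span {(1, \<mu>)}" for v
  proof -
    obtain u1 v1 u2 v2 where v: "v = (u1, v1, u2, v2)" by (cases v)
    have "momentum_derivative c ?\<zeta> v = (2 * (r1 * u1 + r2 * u2),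
        - (r1 * u1) / m1 - (r2 * u2) / m2 - c / d * ((- r) * (u2 - u1)))"
      using r21 r by (simp add: v momentum_derivative_def m1_def m2_def)
    also have "- (r1 * u1) / m1 - (r2 * u2) / m2 - c / d * ((- r) * (u2 - u1))
        = (- r1 / m1 - c / d * r) * u1 + (- r2 / m2 + c / d * r) * u2"
      by (simp add: algebra_simps add_divide_distrib)
    also have "(2 * (r1 * u1 + r2 * u2), (- r1 / m1 - c / d * r) * u1 + (- r2 / m2 + c / d * r) * u2)
        = (2 * (r1 * u1 + r2 * u2)) *\<^sub>R (1, \<mu>)"
      unfolding first second by (simp add: algebra_simps)
    finally have eq: "momentum_derivative c ?\<zeta> v = (2 * (r1 * u1 + r2 * u2)) *\<^sub>R (1, \<mu>)" .
    show ?thesis unfolding eq by (intro span_scale span_base) simp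
  qed
  then have "range (momentum_derivative c ?\<zeta>) \<subseteq> span {(1, \<mu>)}" by blast
  then have "dim (range (momentum_derivative c ?\<zeta>)) \<le> card {(1 :: real, \<mu>)}"
    by (rule dim_le_card) simp
  then have "?\<zeta> \<in> critical_points c"
    using surf by (simp add: critical_points_iff integral_surface_def)
  moreover have "momentum_map c ?\<zeta> = (f, h)" using surf by (simp add: integral_surface_def)
  ultimately show ?thesis unfolding bifurcation_diagram_def by (metis image_eqI)
qed

section \<open>Sign patterns of the radicand\<close>

text \<open>A positive second derivative makes the radicand positive on both sides of
  \<open>d0\<close>. Being negative at 0, it has a further zero \<open>e\<close> to the left. The
  zero count excludes all others, so the sign is constant on each remaining gap.\<close>

lemma ysq_double_root_shape:
  assumes c: "c > 2" and k: "k > 0" and f: "f < 2" and d0: "d0 > 0"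
    and y: "ysq c f k d0 = 0" "dysq c f k d0 = 0" "ddysq c k d0 > 0"
  obtains e where "0 < e" "e < d0"
    "\<forall>d. d > 0 \<longrightarrow> (ysq c f k d \<ge> 0 \<longleftrightarrow> e \<le> d)"
    "\<forall>d. d > 0 \<longrightarrow> (ysq c f k d = 0 \<longleftrightarrow> d = e \<or> d = d0)"
    "\<forall>d. 0 < d \<longrightarrow> d \<le> e \<longrightarrow> dysq c f k d > 0"
proof -
  have deriv: "(dysq c f k has_real_derivative ddysq c k d0) (at d0)"
    using dysq_has_derivative d0 by blast
  have cont: "continuous_on S (ysq c f k)" if "S \<subseteq> {0..}" for S
    using c that by (intro continuous_on_subset[OF continuous_on_ysq]) auto
  have y0: "ysq c f k 0 < 0" using f by (simp add: ysq_zero)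
  obtain \<delta> where \<delta>: "\<delta> > 0" "\<And>x. x > 0 \<Longrightarrow> x < \<delta> \<Longrightarrow> dysq c f k (d0 - x) < 0"
    using DERIV_pos_inc_left[OF deriv y(3)] y by auto
  obtain \<delta>' where \<delta>': "\<delta>' > 0" "\<And>x. x > 0 \<Longrightarrow> x < \<delta>' \<Longrightarrow> dysq c f k (d0 + x) > 0"
    using DERIV_pos_inc_right[OF deriv y(3)] y by auto
  \<comment> \<open>A sample point close enough to \<open>d0\<close> for the derivative to be
    negative from there on; the minimum keeps it positive.\<close>
  define l where "l = d0 - min \<delta> d0 / 2"
  have l: "0 < l" "l < d0" "d0 - l < \<delta>" using d0 \<delta> by (auto simp: l_def min_def)
  have yl: "ysq c f k l > 0"
  proof -
    obtain z where z: "l < z" "z < d0" "ysq c f k d0 - ysq c f k l = (d0 - l) * dysq c f k z"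
      using MVT2[of l d0 "ysq c f k" "dysq c f k"] l ysq_has_derivative by auto
    have "dysq c f k z < 0" using \<delta>(2)[of "d0 - z"] z l by simp
    then have "(d0 - l) * dysq c f k z < 0" using l by (simp add: mult_pos_neg)
    then show ?thesis using z y by simp
  qed
  define r where "r = d0 + \<delta>' / 2"
  have r: "d0 < r" "r - d0 < \<delta>'" using \<delta>' by (auto simp: r_def)
  have yr: "ysq c f k r > 0"
  proof -
    obtain z where z: "d0 < z" "z < r" "ysq c f k r - ysq c f k d0 = (r - d0) * dysq c f k z"
      using MVT2[of d0 r "ysq c f k" "dysq c f k"] r d0 ysq_has_derivative by auto
    have "dysq c f k z > 0" using \<delta>'(2)[of "z - d0"] z r by simp
    then have "(r - d0) * dysq c f k z > 0" using r by simp
    then show ?thesis using z y by simp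
  qed
  obtain e where e: "0 \<le> e" "e \<le> l" "ysq c f k e = 0"
    using IVT'[of "ysq c f k" 0 0 l] y0 yl l cont by auto
  have e0: "0 < e" "e < d0" using e y0 l by (auto simp: less_le)
  have el: "e < l" using e yl by (auto simp: less_le)
  have zeros: "d = e \<or> d = d0" if "d > 0" "ysq c f k d = 0" for d
    using ysq_double_zero(1)[OF c k e0 e(3) y(1,2)] that by blast
  have neg: "ysq c f k d < 0" if "0 < d" "d < e" for d
    proof (rule continuous_no_zero_same_sign'[of "{0..<e}" "ysq c f k" 0])
      show "continuous_on {0..<e} (ysq c f k)" by (rule cont) (use e0 e l r yl yr in auto)
      show "ysq c f k z \<noteq> 0" if "z \<in> {0..<e}" for z using that zeros[of z] e0 e l r yl yr y0 by force
    qed (use that e0 el e l r yl yr y0 in \<open>auto simp: is_interval_1\<close>)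
  have pos: "ysq c f k d > 0" if "e < d" "d < d0" for d
    proof (rule continuous_no_zero_same_sign[of "{e<..<d0}" "ysq c f k" l])
      show "continuous_on {e<..<d0} (ysq c f k)" by (rule cont) (use e0 e l r yl yr in auto)
      show "ysq c f k z \<noteq> 0" if "z \<in> {e<..<d0}" for z using that zeros[of z] e0 e l r yl yr y0 by force
    qed (use that e0 el e l r yl yr  in \<open>auto simp: is_interval_1\<close>)
  have pos': "ysq c f k d > 0" if "d0 < d" for d
    proof (rule continuous_no_zero_same_sign[of "{d0<..}" "ysq c f k" r])
      show "continuous_on {d0<..} (ysq c f k)" by (rule cont) (use e0 e l r yl yr in auto)
      show "ysq c f k z \<noteq> 0" if "z \<in> {d0<..}" for z using that zeros[of z] e0 e l r yl yr y0 by force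
    qed (use that e0 el e l r yl yr  in \<open>auto simp: is_interval_1\<close>)
  show thesis
  proof (rule that; (intro allI impI)?)
    show "0 < e" "e < d0" by fact+
    show "ysq c f k d \<ge> 0 \<longleftrightarrow> e \<le> d" if "d > 0" for d
      using neg[of d] pos[of d] pos'[of d] that e y by (cases d d0 rule: linorder_cases) force+
    show "ysq c f k d = 0 \<longleftrightarrow> d = e \<or> d = d0" if "d > 0" for d
      using zeros that e y by blast
    \<comment> \<open>The rise from a negative value to 0 yields one point below \<open>e\<close>
      with positive derivative; as the derivative has no zero on (0, e], it is positive
      throughout.\<close>
    obtain z where z: "e / 2 < z" "z < e" "ysq c f k e - ysq c f k (e / 2) = (e - e / 2) * dysq c f k z"
      using MVT2[of "e / 2" e "ysq c f k" "dysq c f k"] e0 ysq_has_derivative by auto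
    have "(e - e / 2) * dysq c f k z > 0" using z(3) neg[of "e / 2"] e e0 by simp
    then have dz: "dysq c f k z > 0" using e0 by (simp add: zero_less_mult_iff)
    show "dysq c f k d > 0" if "0 < d" "d \<le> e" for d
    proof (rule continuous_no_zero_same_sign[of "{0<..e}" "dysq c f k" z])
      show "continuous_on {0<..e} (dysq c f k)"
        by (rule DERIV_continuous_on) (auto intro: has_field_derivative_at_within dysq_has_derivative)
      show "dysq c f k x \<noteq> 0" if "x \<in> {0<..e}" for x
        using ysq_double_zero(2)[OF c k e0 e(3) y(1,2)] that by auto
    qed (use that z e0 dz in \<open>auto simp: is_interval_1\<close>)
  qed
qed

lemma ysq_mono_k: "d > 0 \<Longrightarrow> k < k' \<Longrightarrow> ysq c f k d < ysq c f k' d"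
  by (simp add: ysq_def)

text \<open>Raising \<open>k\<close> raises both the radicand and its derivative. Up to
  \<open>e\<close> it still increases from a negative value, so it crosses zero once, now earlier.
  Beyond \<open>e\<close> it was nonnegative and becomes positive, which removes the double
  zero.\<close>

lemma ysq_single_zero_above:
  assumes c: "c > 2" and k: "k' > k" and f: "f < 2" and e: "0 < e"
    and nonneg: "\<And>d. d > 0 \<Longrightarrow> ysq c f k d \<ge> 0 \<longleftrightarrow> e \<le> d"
    and incr: "\<And>d. 0 < d \<Longrightarrow> d \<le> e \<Longrightarrow> dysq c f k d > 0"
  obtains e' where "0 < e'" "e' < e"
    "\<forall>d. d > 0 \<longrightarrow> (ysq c f k' d \<ge> 0 \<longleftrightarrow> e' \<le> d)"
    "\<forall>d. d > 0 \<longrightarrow> (ysq c f k' d = 0 \<longleftrightarrow> d = e')"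
    "dysq c f k' e' > 0"
proof -
  have "ysq c f k' e > 0" using ysq_mono_k[OF e k] nonneg[OF e] by (meson le_less_trans order_refl)
  moreover have "ysq c f k' 0 < 0" using f by (simp add: ysq_zero)
  moreover have "continuous_on {0..e} (ysq c f k')"
    using c by (intro continuous_on_subset[OF continuous_on_ysq]) auto
  ultimately obtain e' where e': "0 \<le> e'" "e' \<le> e" "ysq c f k' e' = 0"
    using IVT'[of "ysq c f k'" 0 0 e] e by auto
  then have e0: "0 < e'" "e' < e" using \<open>ysq c f k' 0 < 0\<close> \<open>ysq c f k' e > 0\<close> by (auto simp: less_le)
  have incr': "dysq c f k' d > 0" if "0 < d" "d \<le> e" for d
  proof -
    have "k * (c * d powr (c - 1)) < k' * (c * d powr (c - 1))"
      using k c that by (intro mult_strict_right_mono) auto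
    then show ?thesis using incr[OF that] by (simp add: dysq_def)
  qed
  have mono: "ysq c f k' a < ysq c f k' b" if "0 < a" "a < b" "b \<le> e" for a b
  proof (rule DERIV_pos_imp_increasing[OF that(2)])
    show "\<exists>y. (ysq c f k' has_real_derivative y) (at x) \<and> 0 < y" if "a \<le> x" "x \<le> b" for x
      using ysq_has_derivative[of x c f k'] incr'[of x] that \<open>0 < a\<close> \<open>b \<le> e\<close> by auto
  qed
  have neg: "ysq c f k' d < 0" if "0 < d" "d < e'" for d
    using mono[OF that] e0 e' by simp
  have pos: "ysq c f k' d > 0" if "e' < d" for d
  proof (cases "d \<le> e")
    case True
    then show ?thesis using mono[of e' d] that e0 e' by simp
  next
    case False
    then have "0 \<le> ysq c f k d" using nonneg[of d] e by simp
    also have "\<dots> < ysq c f k' d" using False e k by (intro ysq_mono_k) auto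
    finally show ?thesis .
  qed
  show thesis
  proof (rule that; (intro allI impI)?)
    show "ysq c f k' d \<ge> 0 \<longleftrightarrow> e' \<le> d" "ysq c f k' d = 0 \<longleftrightarrow> d = e'" if "d > 0" for d
      using neg[of d] pos[of d] that e' by (cases d e' rule: linorder_cases; force)+
  qed (use e0 incr' in auto)
qed

text \<open>The signs -, +, -, + at 0, \<open>m\<close>, \<open>d\<close>, \<open>r\<close> force
  three zeros. The zero count shows that there are no others and that all are simple.\<close>

lemma ysq_three_zeros_shape:
  assumes c: "c > 2" and k: "k > 0" and f: "f < 2"
    and m: "0 < m" "m < d" "d < r"
    and y: "ysq c f k m > 0" "ysq c f k d < 0" "ysq c f k r > 0"
  obtains e1 e2 e3 where "0 < e1" "e1 < e2" "e2 < e3" "e3 < r"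
    "\<forall>d. d > 0 \<longrightarrow> (ysq c f k d \<ge> 0 \<longleftrightarrow> e1 \<le> d \<and> d \<le> e2 \<or> e3 \<le> d)"
    "\<forall>d. d > 0 \<longrightarrow> (ysq c f k d = 0 \<longleftrightarrow> d = e1 \<or> d = e2 \<or> d = e3)"
    "\<forall>d. d > 0 \<longrightarrow> ysq c f k d = 0 \<longrightarrow> dysq c f k d \<noteq> 0"
proof -
  let ?y = "ysq c f k"
  have cont: "continuous_on S ?y" if "S \<subseteq> {0..}" for S
    using c that by (intro continuous_on_subset[OF continuous_on_ysq]) auto
  have y0: "?y 0 < 0" using f by (simp add: ysq_zero)
  obtain e1 where e1: "0 \<le> e1" "e1 \<le> m" "?y e1 = 0"
    using IVT'[of ?y 0 0 m] y0 y m cont by auto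
  obtain e2 where e2: "m \<le> e2" "e2 \<le> d" "?y e2 = 0"
    using IVT2'[of ?y d 0 m] y m cont by auto
  obtain e3 where e3: "d \<le> e3" "e3 \<le> r" "?y e3 = 0"
    using IVT'[of ?y d 0 r] y m cont by auto
  have e: "0 < e1" "e1 < m" "m < e2" "e2 < d" "d < e3" "e3 < r"
    using e1 e2 e3 y y0 by (auto simp: less_le)
  have zeros: "d \<in> {e1, e2, e3} \<and> dysq c f k d \<noteq> 0" if "d > 0" "?y d = 0" for d
    using ysq_three_zeros[OF c k, of e1 e2 e3 f d] e e1 e2 e3 that by auto
  have n: "?y x < 0" if "0 \<le> x" "x < e1" for x
    proof (rule continuous_no_zero_same_sign'[of "{0..<e1}" "ysq c f k" 0])
      show "continuous_on {0..<e1} (ysq c f k)" by (rule cont) (use e m y in auto)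
      show "ysq c f k z \<noteq> 0" if "z \<in> {0..<e1}" for z using that zeros[of z] e m y y0 by force
    qed (use that e m y y0 in \<open>auto simp: is_interval_1\<close>)
  have p: "?y x > 0" if "e1 < x" "x < e2" for x
    proof (rule continuous_no_zero_same_sign[of "{e1<..<e2}" "ysq c f k" m])
      show "continuous_on {e1<..<e2} (ysq c f k)" by (rule cont) (use e m y in auto)
      show "ysq c f k z \<noteq> 0" if "z \<in> {e1<..<e2}" for z using that zeros[of z] e m y y0 by force
    qed (use that e m y  in \<open>auto simp: is_interval_1\<close>)
  have n': "?y x < 0" if "e2 < x" "x < e3" for x
    proof (rule continuous_no_zero_same_sign'[of "{e2<..<e3}" "ysq c f k" d])
      show "continuous_on {e2<..<e3} (ysq c f k)" by (rule cont) (use e m y in auto)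
      show "ysq c f k z \<noteq> 0" if "z \<in> {e2<..<e3}" for z using that zeros[of z] e m y y0 by force
    qed (use that e m y  in \<open>auto simp: is_interval_1\<close>)
  have p': "?y x > 0" if "e3 < x" for x
    proof (rule continuous_no_zero_same_sign[of "{e3<..}" "ysq c f k" r])
      show "continuous_on {e3<..} (ysq c f k)" by (rule cont) (use e m y in auto)
      show "ysq c f k z \<noteq> 0" if "z \<in> {e3<..}" for z using that zeros[of z] e m y y0 by force
    qed (use that e m y  in \<open>auto simp: is_interval_1\<close>)
  show thesis
  proof (rule that; (intro allI impI)?)
    show "?y x \<ge> 0 \<longleftrightarrow> e1 \<le> x \<and> x \<le> e2 \<or> e3 \<le> x" if "x > 0" for x
    proof -
      consider "x < e1" | "x = e1 \<or> x = e2 \<or> x = e3" | "e1 < x" "x < e2" | "e2 < x" "x < e3" | "e3 < x"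
        by linarith
      then show ?thesis
      proof cases
        case 1
        then show ?thesis using n[of x] that e by auto
      next
        case 2
        then show ?thesis using e1 e2 e3 e by auto
      next
        case 3
        then show ?thesis using p[of x] e by auto
      next
        case 4
        then show ?thesis using n'[of x] e by auto
      next
        case 5
        then show ?thesis using p'[of x] e by auto
      qed
    qed
    show "?y x = 0 \<longleftrightarrow> x = e1 \<or> x = e2 \<or> x = e3" if "x > 0" for x
      using zeros that e1 e2 e3 by blast
    show "dysq c f k x \<noteq> 0" if "x > 0" "?y x = 0" for x
      using zeros that by blast
  qed (use e in auto)
qed

section \<open>The arc AB and its two sides\<close>

text \<open>The double zero of \<^const>\<open>ysq\<close> on the level \<open>gamma2 c s\<close>; it is the argument of the second
  logarithm in \<^const>\<open>gamma2\<close>.\<close>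

definition arc_sep :: "real \<Rightarrow> real \<Rightarrow> real" where
  "arc_sep c s = c * s\<^sup>2 / (c + s - 1)"

definition arc_f :: "real \<Rightarrow> real \<Rightarrow> real" where
  "arc_f c s = arc_sep c s - 2 * (s - 1)"

definition arc_k :: "real \<Rightarrow> real \<Rightarrow> real" where
  "arc_k c s = 4 * (s\<^sup>2 * (s - 1) / (c + s - 1)) / arc_sep c s powr c"

definition arc_h :: "real \<Rightarrow> real \<Rightarrow> real" where
  "arc_h c s = 1/2 * ln (s\<^sup>2 * (s - 1) / (c + s - 1)) - c/2 * ln (arc_sep c s)"

lemma gamma2_eq: "c + s - 1 > 0 \<Longrightarrow> gamma2 c s = (arc_f c s, arc_h c s)"
  by (simp add: gamma2_def arc_f_def arc_h_def arc_sep_def diff_divide_distrib)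

text \<open>Coordinates are the arc parameter and the vertical offset in \<open>h\<close>. The arc
  becomes the line of zero offset, and its sides are the two signs of the offset.\<close>

definition arc_chart :: "real \<Rightarrow> real \<times> real \<Rightarrow> real \<times> real" where
  "arc_chart c z = (arc_f c (fst z), arc_h c (fst z) + snd z)"

abbreviation arc_strip :: "real \<Rightarrow> (real \<times> real) set" where
  "arc_strip c \<equiv> {s_A c<..<s_B c} \<times> UNIV"

section \<open>The parameter range between A and B\<close>

context
  fixes c :: real
  assumes c: "c > 2"
begin

text \<open>The quadratic equals (c - 2)(s + c - 1)^2 - c (c - 1)^2, and \<open>s_A c\<close> is its
  larger root. Its sign is that of the derivative of \<open>arc_f\<close> and also that of
  \<open>ddysq\<close> at the double zero; both vanish at the cusp A.\<close>

lemma s_A_bound: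
  assumes "s_A c < s"
  shows "s > 1" "(c - 2) * s\<^sup>2 + 2 * (c - 1) * (c - 2) * s - 2 * (c - 1)\<^sup>2 > 0"
proof -
  define q where "q = sqrt (c * (c - 2))"
  have q: "q > 0" "q\<^sup>2 = c * (c - 2)" using c by (auto simp: q_def)
  have "(q - (c - 2)) * (c - 1) < s * (c - 2)"
    using assms c by (simp add: s_A_def q_def field_simps)
  then have less: "q * (c - 1) < (s + c - 1) * (c - 2)" by (simp add: algebra_simps)
  \<comment> \<open>Comparison of squares for s_A > 1: the square of q (c - 1) exceeds that of c (c
    - 2) by c (c - 2).\<close>
  have "(q * (c - 1))\<^sup>2 - (c * (c - 2))\<^sup>2 = c * (c - 2)"
    unfolding power_mult_distrib q by (simp add: power2_eq_square algebra_simps)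
  moreover have "c * (c - 2) > 0" using c by simp
  ultimately have "(c * (c - 2))\<^sup>2 < (q * (c - 1))\<^sup>2" by linarith
  then have "c * (c - 2) < q * (c - 1)" using c q by (intro power2_less_imp_less[of "c * (c - 2)"]) auto
  then have "c * (c - 2) < (s + c - 1) * (c - 2)" using less by simp
  then show s: "s > 1" using c by simp
  have "(q * (c - 1))\<^sup>2 < ((s + c - 1) * (c - 2))\<^sup>2"
    using less c q s by (intro power_strict_mono) auto
  then have "(c - 2) * (c * (c - 1)\<^sup>2) < (c - 2) * ((s + c - 1)\<^sup>2 * (c - 2))"
    unfolding power_mult_distrib q by (simp add: power2_eq_square algebra_simps)
  then have "c * (c - 1)\<^sup>2 < (s + c - 1)\<^sup>2 * (c - 2)" using c by simp
  then show "(c - 2) * s\<^sup>2 + 2 * (c - 1) * (c - 2) * s - 2 * (c - 1)\<^sup>2 > 0"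
    by (simp add: power2_eq_square algebra_simps)
qed

text \<open>With q = sqrt c the second inequality is the square of 2 (s - 1) < q (2 - s). It amounts
  to \<open>arc_sep c s < 2 * arc_f c s\<close>; equality, that is X = Y = 0 at the double zero,
  marks the tangency B.\<close>

lemma s_B_bound:
  assumes "s < s_B c" "s > 1"
  shows "s < 2" "4 * (s - 1) * (c + s - 1) < c * s\<^sup>2"
proof -
  define q where "q = sqrt c"
  have q: "q > 0" "q\<^sup>2 = c" using c by (auto simp: q_def)
  have less: "s * (2 + q) < 2 * (1 + q)"
    using assms(1) q by (simp add: s_B_def field_simps flip: q_def)
  then have *: "2 * (s - 1) < q * (2 - s)" by (simp add: algebra_simps)
  then have "0 < q * (2 - s)" using assms(2) by simp
  then show s: "s < 2" using q by (simp add: zero_less_mult_iff)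
  have "(2 * (s - 1))\<^sup>2 < (q * (2 - s))\<^sup>2"
    using * assms(2) by (intro power_strict_mono) auto
  then show "4 * (s - 1) * (c + s - 1) < c * s\<^sup>2"
    unfolding power_mult_distrib q by (simp add: power2_eq_square algebra_simps)
qed

lemma arc_sep_pos: "s > 1 \<Longrightarrow> arc_sep c s > 0"
  using c by (simp add: arc_sep_def)

lemma arc_k_pos: "s > 1 \<Longrightarrow> arc_k c s > 0"
  unfolding arc_k_def using c arc_sep_pos[of s] by (intro divide_pos_pos mult_pos_pos) auto

lemma arc_k_eq: "s > 1 \<Longrightarrow> arc_k c s = 4 * exp (2 * arc_h c s)"
proof -
  assume s: "s > 1"
  have "exp (2 * arc_h c s) = exp (ln (s\<^sup>2 * (s - 1) / (c + s - 1)) - c * ln (arc_sep c s))"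
    by (simp add: arc_h_def)
  also have "\<dots> = s\<^sup>2 * (s - 1) / (c + s - 1) / arc_sep c s powr c"
    using s c arc_sep_pos[OF s] by (simp add: exp_diff powr_def)
  finally show ?thesis by (simp add: arc_k_def)
qed

text \<open>With d = \<open>arc_sep c s\<close> one has 2 - f = 2s - d, k d^c = 4 (s^2 - d) and c k
  d^(c-1) = 4 (s - 1), and these make \<open>ysq\<close> and \<open>dysq\<close> vanish. The bound
  \<open>s > s_A c\<close> makes the zero a local minimum, and \<open>s < s_B c\<close> places it at
  X different from 0.\<close>

lemma arc_double_root:
  assumes "s_A c < s" "s < s_B c"
  shows "arc_f c s < 2" "arc_sep c s < 2 * arc_f c s"
    "ysq c (arc_f c s) (arc_k c s) (arc_sep c s) = 0"
    "dysq c (arc_f c s) (arc_k c s) (arc_sep c s) = 0"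
    "ddysq c (arc_k c s) (arc_sep c s) > 0"
proof -
  note s = s_A_bound[OF assms(1)] s_B_bound[OF assms(2) s_A_bound(1)[OF assms(1)]]
  define d where "d = arc_sep c s"
  have d: "d > 0" using arc_sep_pos s by (simp add: d_def)
  have n: "c + s - 1 > 0" using s c by simp
  have dn: "d * (c + s - 1) = c * s\<^sup>2" using n by (simp add: d_def arc_sep_def)
  have f: "arc_f c s = d - 2 * (s - 1)" by (simp add: arc_f_def d_def)
  have kd: "arc_k c s * d powr c = 4 * (s\<^sup>2 * (s - 1) / (c + s - 1))"
    using d by (simp add: arc_k_def d_def)
  have kd': "c * (arc_k c s * d powr c) = 4 * (s - 1) * d"
    unfolding kd by (simp add: d_def arc_sep_def)
  have "4 * (s - 1) * (c + s - 1) < d * (c + s - 1)" using s(4) dn by simp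
  then have ds: "4 * (s - 1) < d" using n by simp
  show "arc_sep c s < 2 * arc_f c s" using ds by (simp add: f flip: d_def)
  have "s * (c * s) < s * (2 * (c + s - 1))"
  proof -
    have "(c - 2) * s < (c - 2) * 2" using s(3) c by (intro mult_strict_left_mono) auto
    then have "c * s < 2 * (c + s - 1)" using c by (simp add: algebra_simps)
    then show ?thesis using s by simp
  qed
  then have "d * (c + s - 1) < (2 * s) * (c + s - 1)"
    unfolding dn by (simp add: power2_eq_square algebra_simps)
  then have "d < 2 * s" using n by simp
  then show "arc_f c s < 2" by (simp add: f)
  show "ysq c (arc_f c s) (arc_k c s) (arc_sep c s) = 0"
  proof -
    have "4 * (s\<^sup>2 * (s - 1) / (c + s - 1)) = 4 * s\<^sup>2 - 4 * d"
    proof -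
      have "s\<^sup>2 * (s - 1) = (s\<^sup>2 - d) * (c + s - 1)"
        using dn by (simp add: algebra_simps)
      then show ?thesis using n by simp
    qed
    then show ?thesis
      unfolding ysq_def f d_def[symmetric] kd by (simp add: power2_eq_square algebra_simps)
  qed
  have dc: "d powr (c - 1) = d powr c / d" "d powr (c - 2) = d powr c / d / d"
    using d by (simp_all add: powr_diff powr_numeral power2_eq_square)
  have kd1: "arc_k c s * c * d powr (c - 1) = 4 * (s - 1)"
    using kd' d by (simp add: dc field_simps)
  show "dysq c (arc_f c s) (arc_k c s) (arc_sep c s) = 0"
    unfolding dysq_def f d_def[symmetric] kd1 by simp
  have "2 * d * (c + s - 1) < 4 * (s - 1) * (c - 1) * (c + s - 1)"
    unfolding mult.assoc[of 2] dn using s(2) by (simp add: power2_eq_square algebra_simps)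
  then have "2 * d < 4 * (s - 1) * (c - 1)" using n by simp
  then have "2 < 4 * (s - 1) * (c - 1) / d" using d by (simp add: field_simps)
  also have "4 * (s - 1) * (c - 1) / d = arc_k c s * c * (c - 1) * d powr (c - 2)"
    unfolding kd1[symmetric] dc by simp
  finally show "ddysq c (arc_k c s) (arc_sep c s) > 0"
    by (simp add: ddysq_def d_def)
qed

text \<open>The numerator of the derivative is the quadratic of \<open>s_A_bound\<close>, positive
  beyond the cusp. Hence the arc is a graph over \<open>f\<close>.\<close>

lemma arc_f_strict_mono:
  assumes "s_A c < s" "s < s'"
  shows "arc_f c s < arc_f c s'"
proof (rule DERIV_pos_imp_increasing[OF assms(2)])
  fix x assume "s \<le> x" "x \<le> s'"
  then have x: "x > 1" "(c - 2) * x\<^sup>2 + 2 * (c - 1) * (c - 2) * x - 2 * (c - 1)\<^sup>2 > 0"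
    using s_A_bound[of x] assms by auto
  have n: "c + x - 1 > 0" using x c by simp
  have "(arc_f c has_real_derivative
      (c * (2 * x) * (c + x - 1) - c * x\<^sup>2 * 1) / ((c + x - 1) * (c + x - 1)) - 2) (at x)"
    unfolding arc_f_def arc_sep_def using n
    by (auto intro!: derivative_eq_intros)
  moreover have "(c * (2 * x) * (c + x - 1) - c * x\<^sup>2 * 1) / ((c + x - 1) * (c + x - 1)) - 2
    = ((c - 2) * x\<^sup>2 + 2 * (c - 1) * (c - 2) * x - 2 * (c - 1)\<^sup>2) / ((c + x - 1) * (c + x - 1))"
  proof -
    have quot: "a / (n * n) - 2 = (a - 2 * (n * n)) / (n * n)" if "n \<noteq> 0" for a n :: real
      using that by (simp add: diff_divide_distrib)
    have num: "c * (2 * x) * (c + x - 1) - c * x\<^sup>2 * 1 - 2 * ((c + x - 1) * (c + x - 1))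
        = (c - 2) * x\<^sup>2 + 2 * (c - 1) * (c - 2) * x - 2 * (c - 1)\<^sup>2"
      by (simp add: power2_eq_square algebra_simps)
    show ?thesis using quot[of "c + x - 1"] num n by simp
  qed
  ultimately show "\<exists>y. (arc_f c has_real_derivative y) (at x) \<and> 0 < y"
    using x n by (metis divide_pos_pos mult_pos_pos)
qed

lemma continuous_on_arc:
  "continuous_on {s_A c<..<s_B c} (arc_sep c)"
  "continuous_on {s_A c<..<s_B c} (arc_f c)"
  "continuous_on {s_A c<..<s_B c} (arc_h c)"
proof -
  have pos: "s > 1" if "s \<in> {s_A c<..<s_B c}" for s using s_A_bound(1) that by simp
  show sep: "continuous_on {s_A c<..<s_B c} (arc_sep c)"
    unfolding arc_sep_def using pos c by (intro continuous_intros) force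
  show "continuous_on {s_A c<..<s_B c} (arc_f c)"
    unfolding arc_f_def by (intro continuous_intros sep)
  have "s\<^sup>2 * (s - 1) / (c + s - 1) \<noteq> 0" "c + s - 1 \<noteq> 0" "arc_sep c s \<noteq> 0" if "s \<in> {s_A c<..<s_B c}" for s
    using pos[OF that] arc_sep_pos[of s] c by auto
  then show "continuous_on {s_A c<..<s_B c} (arc_h c)"
    unfolding arc_h_def by (intro continuous_intros sep) auto
qed

section \<open>Levels on, above and below the arc\<close>

lemma arc_critical_level:
  assumes s: "s_A c < s" "s < s_B c"
  shows "(arc_f c s, arc_h c s) \<in> bifurcation_diagram c"
    and "integral_surface c (arc_f c s, arc_h c s) homeomorphic circle \<times> three_circle_chain"
proof -
  let ?f = "arc_f c s" and ?k = "arc_k c s" and ?d = "arc_sep c s"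
  have s1: "s > 1" using s_A_bound s by blast
  note k = arc_k_eq[OF s1]
  note root = arc_double_root[OF s]
  have d: "?d > 0" using arc_sep_pos s1 by blast
  \<comment> \<open>At any zero \<open>d\<close> of the radicand X^2 = d (2f - d), so
    \<open>d < 2 * f\<close> makes the half width positive.\<close>
  have "(2 - ?f)\<^sup>2 - ?k * ?d powr c = ?d * (2 * ?f - ?d)"
    using root(3) by (simp add: ysq_def power2_eq_square algebra_simps)
  also have "\<dots> > 0" using d root(2) by simp
  finally have pos: "(2 - ?f)\<^sup>2 - ?k * ?d powr c > 0" .
  show "(arc_f c s, arc_h c s) \<in> bifurcation_diagram c"
    using c by (intro critical_value[OF _ root(1) d root(3,4)[unfolded k] pos[unfolded k]]) simp
  obtain e where e: "0 < e" "e < ?d"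
    "\<forall>d. d > 0 \<longrightarrow> (ysq c ?f ?k d \<ge> 0 \<longleftrightarrow> e \<le> d)"
    "\<forall>d. d > 0 \<longrightarrow> (ysq c ?f ?k d = 0 \<longleftrightarrow> d = e \<or> d = ?d)"
    "\<forall>d. 0 < d \<longrightarrow> d \<le> e \<longrightarrow> dysq c ?f ?k d > 0"
    using ysq_double_root_shape[OF c arc_k_pos[OF s1] root(1) d root(3-5)] by blast
  show "integral_surface c (arc_f c s, arc_h c s) homeomorphic circle \<times> three_circle_chain"
    using c pos by (intro integral_surface_chain[OF _ root(1) k e(1,2) _ e(3,4)[rule_format]]) (simp_all add: half_width_def)
qed

text \<open>The offset may be any positive number, because the sign pattern obtained by raising
  \<open>k\<close> persists for every larger \<open>k\<close>.\<close>

lemma arc_above_one_torus: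
  assumes s: "s_A c < s" "s < s_B c" and t: "t > 0"
  shows "liouville_tori c 1 (arc_f c s, arc_h c s + t)"
proof -
  let ?f = "arc_f c s" and ?k = "arc_k c s" and ?d = "arc_sep c s"
  have s1: "s > 1" using s_A_bound s by blast
  define k' where "k' = 4 * exp (2 * (arc_h c s + t))"
  have k': "k' > ?k" using t by (simp add: k'_def arc_k_eq[OF s1])
  note root = arc_double_root[OF s]
  have d: "?d > 0" using arc_sep_pos s1 by blast
  obtain e where e: "0 < e" "e < ?d"
    "\<forall>d. d > 0 \<longrightarrow> (ysq c ?f ?k d \<ge> 0 \<longleftrightarrow> e \<le> d)"
    "\<forall>d. d > 0 \<longrightarrow> (ysq c ?f ?k d = 0 \<longleftrightarrow> d = e \<or> d = ?d)"
    "\<forall>d. 0 < d \<longrightarrow> d \<le> e \<longrightarrow> dysq c ?f ?k d > 0"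
    using ysq_double_root_shape[OF c arc_k_pos[OF s1] root(1) d root(3-5)] by blast
  obtain e' where e': "0 < e'" "e' < e"
    "\<forall>d. d > 0 \<longrightarrow> (ysq c ?f k' d \<ge> 0 \<longleftrightarrow> e' \<le> d)"
    "\<forall>d. d > 0 \<longrightarrow> (ysq c ?f k' d = 0 \<longleftrightarrow> d = e')"
    "dysq c ?f k' e' > 0"
    using ysq_single_zero_above[OF c k' root(1) e(1) e(3,5)[rule_format]] by blast
  have "(2 - ?f)\<^sup>2 - k' * e' powr c = e' * (2 * ?f - e')"
    using e'(1) e'(4)[rule_format, of e'] by (simp add: ysq_def power2_eq_square algebra_simps)
  also have "\<dots> > 0" using e e' root(2) by simp
  finally have "half_width c ?f k' e' > 0" by (simp add: half_width_def)
  then have "integral_surface c (?f, arc_h c s + t) homeomorphic {1..1::nat} \<times> (circle \<times> circle)"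
    using c by (intro integral_surface_one_torus[OF _ root(1) k'_def e'(1) _ e'(3,4)[rule_format]]) simp_all
  moreover have "(?f, arc_h c s + t) \<notin> bifurcation_diagram c"
  proof (rule regular_value)
    show "d \<noteq> 2 * ?f \<and> dysq c ?f (4 * exp (2 * (arc_h c s + t))) d \<noteq> 0"
      if "d > 0" "ysq c ?f (4 * exp (2 * (arc_h c s + t))) d = 0" for d
    proof -
      have "d = e'" using e'(4) that by (simp add: k'_def)
      then show ?thesis unfolding k'_def[symmetric] using e(2) e'(2,5) root(2) by auto
    qed
  qed (use c in simp)
  ultimately show ?thesis by (simp add: liouville_tori_def)
qed

text \<open>The last sample point is \<open>2 * f\<close>: a positive value there puts the third
  zero below it, so X^2 = e3 (2f - e3) > 0, and excludes the critical case
  \<open>d = 2 * f\<close>.\<close>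

lemma three_tori_level:
  assumes k: "k = 4 * exp (2 * h)" and f: "f < 2" and m: "0 < m" "m < d" "d < 2 * f"
    and y: "ysq c f k m > 0" "ysq c f k d < 0" "ysq c f k (2 * f) > 0"
  shows "liouville_tori c 3 (f, h)"
proof -
  have k0: "k > 0" by (simp add: k)
  obtain e1 e2 e3 where e: "0 < e1" "e1 < e2" "e2 < e3" "e3 < 2 * f"
    "\<forall>d. d > 0 \<longrightarrow> (ysq c f k d \<ge> 0 \<longleftrightarrow> e1 \<le> d \<and> d \<le> e2 \<or> e3 \<le> d)"
    "\<forall>d. d > 0 \<longrightarrow> (ysq c f k d = 0 \<longleftrightarrow> d = e1 \<or> d = e2 \<or> d = e3)"
    "\<forall>d. d > 0 \<longrightarrow> ysq c f k d = 0 \<longrightarrow> dysq c f k d \<noteq> 0"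
    using ysq_three_zeros_shape[OF c k0 f m y] by blast
  have "(2 - f)\<^sup>2 - k * e3 powr c = e3 * (2 * f - e3)"
    using e(1-3) e(6)[rule_format, of e3] by (simp add: ysq_def power2_eq_square algebra_simps)
  also have "\<dots> > 0" using e by simp
  finally have "half_width c f k e3 > 0" by (simp add: half_width_def)
  then have "integral_surface c (f, h) homeomorphic {1..3::nat} \<times> (circle \<times> circle)"
    using c by (intro integral_surface_three_tori[OF _ f k e(1-3) _ e(5,6)[rule_format]]) simp_all
  moreover have "(f, h) \<notin> bifurcation_diagram c"
  proof (rule regular_value)
    show "d \<noteq> 2 * f \<and> dysq c f (4 * exp (2 * h)) d \<noteq> 0"
      if "d > 0" "ysq c f (4 * exp (2 * h)) d = 0" for d
      using e(7)[rule_format, of d] that y unfolding k by auto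
  qed (use c in simp)
  ultimately show ?thesis by (simp add: liouville_tori_def)
qed

lemma continuous_on_arc_fst:
  "continuous_on (arc_strip c) (\<lambda>z. arc_sep c (fst z))"
  "continuous_on (arc_strip c) (\<lambda>z. arc_f c (fst z))"
  "continuous_on (arc_strip c) (\<lambda>z. arc_h c (fst z))"
  by (rule continuous_on_arc[THEN continuous_on_compose2]; auto intro!: continuous_intros)+

lemma continuous_on_arc_chart: "continuous_on (arc_strip c) (arc_chart c)"
  unfolding arc_chart_def by (intro continuous_intros continuous_on_arc_fst)

lemma inj_on_arc_chart: "inj_on (arc_chart c) (arc_strip c)"
proof (rule inj_onI)
  fix z z' assume z: "z \<in> arc_strip c" "z' \<in> arc_strip c" and eq: "arc_chart c z = arc_chart c z'"
  have "fst z = fst z'"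
    using arc_f_strict_mono[of "fst z" "fst z'"] arc_f_strict_mono[of "fst z'" "fst z"] z eq
    by (cases "fst z" "fst z'" rule: linorder_cases) (auto simp: arc_chart_def)
  then show "z = z'" using eq by (simp add: arc_chart_def prod_eq_iff)
qed

text \<open>Invariance of domain, applied to a continuous injective map of the plane.\<close>

lemma open_arc_chart_image: "open N \<Longrightarrow> N \<subseteq> arc_strip c \<Longrightarrow> open (arc_chart c ` N)"
  by (intro invariance_of_domain continuous_on_subset[OF continuous_on_arc_chart]
      inj_on_subset[OF inj_on_arc_chart]) auto

lemma arc_AB_eq: "arc_AB c = arc_chart c ` ({s_A c<..<s_B c} \<times> {0})"
proof -
  have "gamma2 c s = arc_chart c (s, 0)" if "s \<in> {s_A c<..<s_B c}" for s
    using s_A_bound(1)[of s] that c by (simp add: gamma2_eq arc_chart_def)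
  then show ?thesis by (force simp: arc_AB_def image_iff)
qed

text \<open>Everything is carried over from the strip: the half strips are connected, disjoint and
  open, and vertical approach reaches each point of the arc.\<close>

lemma arc_sides:
  "sides_of (arc_AB c) (arc_chart c ` ({s_A c<..<s_B c} \<times> {..<0})) (arc_chart c ` ({s_A c<..<s_B c} \<times> {0<..}))"
proof -
  let ?I = "{s_A c<..<s_B c}"
  have conn: "connected (arc_chart c ` (?I \<times> T))" if "connected T" for T
    using that by (intro connected_continuous_image continuous_on_subset[OF continuous_on_arc_chart]
        connected_Times) auto
  have disj: "arc_chart c ` (?I \<times> T) \<inter> arc_chart c ` (?I \<times> T') = {}" if "T \<inter> T' = {}" for T T'
    using that by (subst inj_on_image_Int[OF inj_on_arc_chart, symmetric]) auto
  have closure: "arc_chart c ` (?I \<times> {0}) \<subseteq> closure (arc_chart c ` (?I \<times> T))"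
    if small: "\<And>e. e > 0 \<Longrightarrow> \<exists>t\<in>T. \<bar>t\<bar> < e" for T
  proof clarsimp
    fix s assume s: "s_A c < s" "s < s_B c"
    show "arc_chart c (s, 0) \<in> closure (arc_chart c ` (?I \<times> T))"
      unfolding closure_approachable
    proof (intro allI impI)
      fix e :: real assume "e > 0"
      then obtain t where t: "t \<in> T" "\<bar>t\<bar> < e" using small by blast
      have "dist (arc_chart c (s, t)) (arc_chart c (s, 0)) = \<bar>t\<bar>"
        by (simp add: arc_chart_def dist_Pair_Pair dist_real_def)
      then show "\<exists>y\<in>arc_chart c ` (?I \<times> T). dist y (arc_chart c (s, 0)) < e"
        using t s by (intro bexI[of _ "arc_chart c (s, t)"]) auto
    qed
  qed
  have "arc_AB c \<union> arc_chart c ` (?I \<times> {..<0}) \<union> arc_chart c ` (?I \<times> {0<..}) = arc_chart c ` arc_strip c"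
    unfolding arc_AB_eq image_Un[symmetric] Sigma_Un_distrib2[symmetric]
    by (rule arg_cong[of _ _ "\<lambda>T. arc_chart c ` (?I \<times> T)"]) auto
  moreover have "open (arc_chart c ` arc_strip c)"
    by (intro open_arc_chart_image open_Times) auto
  moreover have "arc_AB c \<subseteq> closure (arc_chart c ` (?I \<times> {..<0}))"
    unfolding arc_AB_eq by (rule closure) (rule_tac x = "- e / 2" in bexI; simp)
  moreover have "arc_AB c \<subseteq> closure (arc_chart c ` (?I \<times> {0<..}))"
    unfolding arc_AB_eq by (rule closure) (rule_tac x = "e / 2" in bexI; simp)
  moreover have "open (arc_chart c ` (?I \<times> {..<0}))" "open (arc_chart c ` (?I \<times> {0<..}))"
    by (intro open_arc_chart_image open_Times; auto)+
  moreover have "arc_AB c \<inter> (arc_chart c ` (?I \<times> {..<0}) \<union> arc_chart c ` (?I \<times> {0<..})) = {}"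
    unfolding arc_AB_eq Int_Un_distrib by (simp add: disj)
  moreover have "{..<0} \<inter> {0<..} = ({} :: real set)" by auto
  ultimately show ?thesis
    unfolding sides_of_def using disj[of "{..<0}" "{0<..}"] by (simp add: conn)
qed

text \<open>A fixed point \<open>m\<close> between the simple and the double zero works for all
  nearby levels: \<open>m < arc_sep\<close>, positivity at \<open>m\<close> and positivity at
  \<open>2 * f\<close> are open conditions in (s, t). The remaining negative value is supplied by t
  < 0, sampled at the moving double zero.\<close>

lemma arc_below_three_tori:
  assumes s: "s_A c < s" "s < s_B c"
  shows "\<exists>N. open N \<and> (s, 0) \<in> N \<and> N \<subseteq> arc_strip c \<and>
    (\<forall>z\<in>N. snd z < 0 \<longrightarrow> liouville_tori c 3 (arc_chart c z))"
proof -
  let ?f = "arc_f c s" and ?k = "arc_k c s" and ?d = "arc_sep c s"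
  have s1: "s > 1" using s_A_bound s by blast
  note root = arc_double_root[OF s]
  have d: "?d > 0" using arc_sep_pos s1 by blast
  obtain e where e: "0 < e" "e < ?d"
    "\<forall>d. d > 0 \<longrightarrow> (ysq c ?f ?k d \<ge> 0 \<longleftrightarrow> e \<le> d)"
    "\<forall>d. d > 0 \<longrightarrow> (ysq c ?f ?k d = 0 \<longleftrightarrow> d = e \<or> d = ?d)"
    "\<forall>d. 0 < d \<longrightarrow> d \<le> e \<longrightarrow> dysq c ?f ?k d > 0"
    using ysq_double_root_shape[OF c arc_k_pos[OF s1] root(1) d root(3-5)] by blast
  define m where "m = (e + ?d) / 2"
  have m: "0 < m" "e < m" "m < ?d" using e by (auto simp: m_def)
  have ym: "ysq c ?f ?k m > 0" using e(3)[rule_format, of m] e(4)[rule_format, of m] m by simp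
  have y2f: "ysq c ?f ?k (2 * ?f) > 0"
    using e(3)[rule_format, of "2 * ?f"] e(4)[rule_format, of "2 * ?f"] e(1,2) root(2) by (simp add: less_le)
  define k where "k z = 4 * exp (2 * (arc_h c (fst z) + snd z))" for z
  define g1 g2 g3 where "g1 z = arc_sep c (fst z) - m"
    and "g2 z = ysq c (arc_f c (fst z)) (k z) m"
    and "g3 z = ysq c (arc_f c (fst z)) (k z) (2 * arc_f c (fst z))" for z
  have contk: "continuous_on (arc_strip c) k"
    unfolding k_def by (intro continuous_intros continuous_on_arc_fst)
  have f0: "2 * arc_f c (fst z) > 0" if "z \<in> arc_strip c" for z
    using arc_double_root(2)[of "fst z"] arc_sep_pos[of "fst z"] s_A_bound(1)[of "fst z"] that by auto
  have cont: "continuous_on (arc_strip c) g1" "continuous_on (arc_strip c) g2" "continuous_on (arc_strip c) g3"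
    unfolding g1_def g2_def g3_def ysq_def
    by (intro continuous_intros continuous_on_arc_fst contk; use f0 m in force)+
  define N where "N = arc_strip c \<inter> g1 -` {0<..} \<inter> g2 -` {0<..} \<inter> g3 -` {0<..}"
  have ostrip: "open (arc_strip c)" by (intro open_Times) auto
  have open_pos: "open (g -` {0<..} \<inter> arc_strip c)" if "continuous_on (arc_strip c) g" for g :: "real \<times> real \<Rightarrow> real"
    using that unfolding continuous_on_open_vimage[OF ostrip] by simp
  have "open ((g1 -` {0<..} \<inter> arc_strip c) \<inter> (g2 -` {0<..} \<inter> arc_strip c) \<inter> (g3 -` {0<..} \<inter> arc_strip c))"
    by (rule open_Int[OF open_Int[OF open_pos[OF cont(1)] open_pos[OF cont(2)]] open_pos[OF cont(3)]])
  also have "(g1 -` {0<..} \<inter> arc_strip c) \<inter> (g2 -` {0<..} \<inter> arc_strip c) \<inter> (g3 -` {0<..} \<inter> arc_strip c) = N"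
    by (auto simp: N_def)
  finally have "open N" .
  moreover have "(s, 0) \<in> N"
  proof -
    have "k (s, 0) = ?k" by (simp add: k_def arc_k_eq[OF s1])
    then show ?thesis using s m ym y2f by (simp add: N_def g1_def g2_def g3_def)
  qed
  moreover have "liouville_tori c 3 (arc_chart c z)" if z: "z \<in> N" "snd z < 0" for z
  proof -
    have s': "s_A c < fst z" "fst z < s_B c" using z by (auto simp: N_def)
    note root' = arc_double_root[OF s']
    have s1': "fst z > 1" using s_A_bound s' by blast
    have "k z < arc_k c (fst z)" using z(2) by (simp add: k_def arc_k_eq[OF s1'])
    \<comment> \<open>On the arc the radicand vanishes at this \<open>arc_sep\<close>; the smaller
      \<open>k\<close> makes it negative there.\<close>
    then have "ysq c (arc_f c (fst z)) (k z) (arc_sep c (fst z)) < 0"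
      using ysq_mono_k[OF arc_sep_pos[OF s1'], of "k z"] root'(3) by metis
    then show ?thesis
      unfolding arc_chart_def using z m root'
      by (intro three_tori_level[of "k z" _ _ m "arc_sep c (fst z)"]) (auto simp: N_def g1_def g2_def g3_def k_def)
  qed
  ultimately show ?thesis by (auto simp: N_def)
qed

end

theorem mainTheorem3:
  fixes c :: real
  assumes "c > 3"
  shows "\<exists>U V. sides_of (arc_AB c) U V \<and>
           (\<forall>P \<in> arc_AB c.
              P \<in> bifurcation_diagram c \<and>
              integral_surface c P homeomorphic (circle \<times> three_circle_chain) \<and>
              (\<forall>\<^sub>F p in nhds P.
                 (p \<in> U \<longrightarrow> liouville_tori c 3 p) \<and> (p \<in> V \<longrightarrow> liouville_tori c 1 p)))"
proof (intro exI conjI ballI)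
  have c: "c > 2" using assms by simp
  let ?I = "{s_A c<..<s_B c}"
  \<comment> \<open>\<open>?U\<close> lies below the arc (smaller \<open>h\<close>) and
    \<open>?V\<close> above it.\<close>
  let ?U = "arc_chart c ` (?I \<times> {..<0})" and ?V = "arc_chart c ` (?I \<times> {0<..})"
  show "sides_of (arc_AB c) ?U ?V" using arc_sides[OF c] .
  fix P assume "P \<in> arc_AB c"
  then obtain s where s: "s_A c < s" "s < s_B c" and P: "P = arc_chart c (s, 0)"
    by (auto simp: arc_AB_eq[OF c])
  have P': "P = (arc_f c s, arc_h c s)" by (simp add: P arc_chart_def)
  show "P \<in> bifurcation_diagram c" "integral_surface c P homeomorphic (circle \<times> three_circle_chain)"
    unfolding P' using arc_critical_level[OF c s] by auto
  obtain N where N: "open N" "(s, 0) \<in> N" "N \<subseteq> ?I \<times> UNIV"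
    "\<forall>z\<in>N. snd z < 0 \<longrightarrow> liouville_tori c 3 (arc_chart c z)"
    using arc_below_three_tori[OF c s] by blast
  have "open (arc_chart c ` N)" using open_arc_chart_image[OF c] N by blast
  moreover have "P \<in> arc_chart c ` N" using N P by blast
  moreover have "liouville_tori c 3 p" if p: "p \<in> arc_chart c ` N" "p \<in> ?U" for p
  proof -
    obtain z z' where z: "z \<in> N" "p = arc_chart c z" "z' \<in> ?I \<times> {..<0}" "p = arc_chart c z'"
      using p by blast
    then have "arc_chart c z = arc_chart c z'" "z \<in> ?I \<times> UNIV" "z' \<in> ?I \<times> UNIV" using N(3) by auto
    \<comment> \<open>Injectivity identifies the preimage in \<open>N\<close> with the one of
      negative offset, so the local result for \<open>N\<close> applies.\<close>
    then have "z = z'" by (rule inj_onD[OF inj_on_arc_chart[OF c]])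
    then show ?thesis using N(4) z by auto
  qed
  moreover have "liouville_tori c 1 p" if "p \<in> ?V" for p
    using that arc_above_one_torus[OF c] by (auto simp: arc_chart_def)
  ultimately show "\<forall>\<^sub>F p in nhds P. (p \<in> ?U \<longrightarrow> liouville_tori c 3 p) \<and> (p \<in> ?V \<longrightarrow> liouville_tori c 1 p)"
    unfolding eventually_nhds by blast
qed

end
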